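(* The map $\Phi:(\mathsf{BString}(n)^p_c)^+\to(\mathsf{TC}^p_c)^+$ is not essentially surjective in general; i.e. there exist $n$, a manifold $M$ and a transitive Courant data over $M$ for $\mathfrak g=\mathfrak{so}(n)$ that is not isomorphic to $\Phi(P_c)$ for any string data $P_c$ over $M$.
   Context: Conventions. $G=\mathrm{Spin}(n)$, $\mathfrak g=\mathfrak{so}(n)$ with the fixed nondegenerate invariant symmetric bilinear form $(-,-)^{\mathfrak g}$ normalised so that $(R,R)^{\mathfrak g}$ represents the real class of $\tfrac12p_1$; $\theta_{MC}$ the right-invariant Maurer–Cartan form; $\mathrm{cs}_3(\theta)=(\theta,d\theta)^{\mathfrak g}+\tfrac13(\theta,[\theta,\theta])^{\mathfrak g}$; $U(1)=\mathbb R/\mathbb Z$, $d\log f$ locally the differential of a real lift; $\check\delta$ the Čech differential. $\mathrm{String}(n)$: the Lie 2-group which is the $\mathsf BU(1)$-central extension of $G$ with class $\tfrac12p_1\in H^4(BG_\bullet,\mathbb Z)\cong H^3(BG_\bullet,\underline{U(1)})$; for a good simplicial hypercover of $BG_\bullet$ and representing cocycle $(\Theta,\Psi,\eta,0)$ it is presented by the Lie groupoid $\Gamma[\eta]=(\sqcup G^{(1)}_{\alpha\beta}\times U(1)\rightrightarrows\sqcup G^{(1)}_\alpha)$, $(g_{\alpha\beta},a)(g_{\beta\gamma},b)=(g_{\alpha\gamma},a+b-\eta_{\alpha\beta\gamma}(g))$, with multiplication defined by $\Psi$ and associator $\Theta$. A morphism $g:U\to\mathrm{String}(n)$ is a principal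 $\Gamma[\eta]$-bundle (bibundle) over $U$, with underlying $\bar g:U\to G$. Over sufficiently fine good covers these bibundles are trivial(ized) and 2-isomorphisms are $U(1)$-valued functions. String data over $M$ (objects of $(\mathsf{BString}(n)^p_c)^+(M)$): an open cover $\{U_i\}$ with $P_c=(\theta_i,B_i;g_{ij},A_{ij},\omega^2_{ij};f_{ijk},\omega^1_{ijk})$: $\theta_i\in\Omega^1(U_i,\mathfrak g)$, $B_i\in\Omega^2(U_i)$, $g_{ij}:U_{ij}\to\mathrm{String}(n)$, $A_{ij}\in\Omega^1(U_{ij})$, $\omega^2_{ij}\in\Omega^2(U_{ij})$, $f_{ijk}:U_{ijk}\to U(1)$ an isomorphism $g_{ik}\Rightarrow g_{ij}g_{jk}$, $\omega^1_{ijk}\in\Omega^1(U_{ijk})$, with $B_j-B_i=dA_{ij}+\omega^2_{ij}$, $\mathrm{cs}_3(\theta_j)-\mathrm{cs}_3(\theta_i)=d\omega^2_{ij}$, $\theta_i-\mathrm{Ad}_{\bar g_{ij}}\theta_j=-\bar g_{ij}^*\theta_{MC}$, $\check\delta A=\omega^1-d\log f$, $\check\delta\omega^2=-d\omega^1$, and the pentagon condition $\check\delta f=F$, $F$ being the function expressing the associator of $\mathrm{String}(n)$ on $(g_{ij},g_{jk},g_{kl})$. In particular $\bar g_{ij}\bar g_{jk}=\bar g_{ik}$. Transitive Courant data over $M$ (objects of $(\mathsf{TC}^p_c)^+(M)$): an open cover with $(\theta_i,B_i;\phi_{ij},\tau_{ij},\beta_{ij})$, i.e. $\theta_i\in\Omega^1(U_i,\mathfrak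 g)$, $B_i\in\Omega^2(U_i)$, and automorphisms $\Lambda_{ij}=\begin{pmatrix}1&0&0\\\phi_{ij}&\tau_{ij}&0\\\beta_{ij}&-2\phi_{ij}^\star\tau_{ij}&1\end{pmatrix}$ of the standard transitive Courant algebroid $TU_{ij}\oplus(U_{ij}\times\mathfrak g)\oplus T^*U_{ij}$ (anchor the projection; pairing $\tfrac12(\xi(Y)+\eta(X))+(a,b)^{\mathfrak g}$; bracket $[X,Y]+X(b)-Y(a)+[a,b]_{\mathfrak g}+L_X\eta-\iota_Yd\xi+2(b,d a)^{\mathfrak g}$; $\tau_{ij}$ a fibrewise orthogonal Lie algebra automorphism; $\phi^\star(a)(X)=(a,\phi(X))^{\mathfrak g}$) which are 1-morphisms from $(\theta_j,B_j)$ to $(\theta_i,B_i)$, with $\Lambda_{ij}\Lambda_{jk}=\Lambda_{ik}$. Here $(\phi,\tau,\beta)$ is a 1-morphism from $(\tilde\theta,\tilde B)$ to $(\theta,B)$ if $\theta=\tau\tilde\theta+\phi$, $\iota_X(\tilde B-B)=\beta(X)+(\theta,\theta(X))^{\mathfrak g}-(\tilde\theta,\tilde\theta(X))^{\mathfrak g}-2\phi^\star\tau(\tilde\theta(X))$, $\mathrm{cs}_3(\tilde\theta)-\mathrm{cs}_3(\theta)=d(\tilde B-B)$. Isomorphisms of Courant data: families of 1-morphisms $\Lambda_i:(\tilde\theta_i,\tilde B_i)\to(\theta_i,B_i)$ (over a common refinement) with $\Lambda_{ij}\Lambda_j=\Lambda_i\tilde\Lambda_{ij}$. $\Phi$ on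 objects: $(\theta_i,B_i;g_{ij},A_{ij},\omega^2_{ij};f_{ijk},\omega^1_{ijk})\mapsto(\theta_i,B_i;-\mu_{ij},\mathrm{Ad}_{\bar g_{ij}},\beta_{ij})$ with $\mu_{ij}=\bar g_{ij}^*\theta_{MC}$ and $\beta_{ij}(X)=\iota_X(dA_{ij}+\omega^2_{ij})+(\mu_{ij}(X),\theta_i(\cdot))^{\mathfrak g}-(\mu_{ij}(\cdot),\theta_i(X))^{\mathfrak g}-(\mu_{ij}(X),\mu_{ij}(\cdot))^{\mathfrak g}$. *)

theory Defs
  imports "HOL-Analysis.Analysis" "Jordan_Normal_Form.Matrix"
begin

hide_const (open) Finite_Cartesian_Product.vec Finite_Cartesian_Product.mat
  Finite_Cartesian_Product.row Finite_Cartesian_Product.transpose Determinants.det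
  Determinants.trace

section \<open>Smooth functions, manifolds and tensor fields\<close>

text \<open>The space R^d is \<^const>\<open>Euclidean_space\<close> d, i.e. the functions nat => real vanishing from
  index d on; in this way the dimension is a term and not a type.
  A function is smooth if all of its iterated partial derivatives exist and are continuous.\<close>

definition pd :: "nat \<Rightarrow> ((nat \<Rightarrow> real) \<Rightarrow> real) \<Rightarrow> (nat \<Rightarrow> real) \<Rightarrow> real" where
  "pd i f x = deriv (\<lambda>t. f (x(i := t))) (x i)"

definition smooth_on :: "nat \<Rightarrow> (nat \<Rightarrow> real) set \<Rightarrow> ((nat \<Rightarrow> real) \<Rightarrow> real) \<Rightarrow> bool" where
  "smooth_on d W f \<longleftrightarrow> (\<forall>is. set is \<subseteq> {..<d} \<longrightarrow>
     continuous_on W (foldr pd is f) \<and>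
     (\<forall>x\<in>W. \<forall>i<d. (\<lambda>t. foldr pd is f (x(i := t))) differentiable (at (x i))))"

type_synonym 'm chart = "'m set \<times> ('m \<Rightarrow> nat \<Rightarrow> real)"

record 'm mfd =
  mdim :: nat
  mtop :: "'m topology"
  matlas :: "'m chart set"

definition chart_inv :: "'m chart \<Rightarrow> (nat \<Rightarrow> real) \<Rightarrow> 'm" where
  "chart_inv c = inv_into (fst c) (snd c)"

definition smooth_manifold :: "'m mfd \<Rightarrow> bool" where
  "smooth_manifold M \<longleftrightarrow>
     Hausdorff_space (mtop M) \<and> second_countable (mtop M) \<and>
     topspace (mtop M) = \<Union> (fst ` matlas M) \<and>
     (\<forall>(U, \<phi>)\<in>matlas M. openin (mtop M) U \<and> openin (Euclidean_space (mdim M)) (\<phi> ` U) \<and>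
        homeomorphic_map (subtopology (mtop M) U)
          (subtopology (Euclidean_space (mdim M)) (\<phi> ` U)) \<phi>) \<and>
     (\<forall>c\<in>matlas M. \<forall>c'\<in>matlas M. \<forall>j<mdim M.
        smooth_on (mdim M) (snd c ` (fst c \<inter> fst c')) (\<lambda>x. snd c' (chart_inv c x) j))"

definition smooth_fun :: "'m mfd \<Rightarrow> 'm set \<Rightarrow> ('m \<Rightarrow> real) \<Rightarrow> bool" where
  "smooth_fun M V f \<longleftrightarrow>
     (\<forall>c\<in>matlas M. smooth_on (mdim M) (snd c ` (V \<inter> fst c)) (\<lambda>x. f (chart_inv c x)))"

definition cpd :: "'m chart \<Rightarrow> nat \<Rightarrow> ('m \<Rightarrow> real) \<Rightarrow> 'm \<Rightarrow> real" where
  "cpd c i f p = pd i (\<lambda>x. f (chart_inv c x)) (snd c p)"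

text \<open>A covariant k-tensor is given by its components in every chart: \<open>\<omega> c p [i1,...,ik]\<close> is the
  value at the point p on the coordinate vectors number i1, ..., ik of the chart c.
  Only charts c of the atlas, points p of the domain of c and indices below the dimension matter.\<close>

type_synonym ('m, 'v) tens = "'m chart \<Rightarrow> 'm \<Rightarrow> nat list \<Rightarrow> 'v"

definition idx :: "nat \<Rightarrow> nat \<Rightarrow> nat list set" where
  "idx d k = {is. length is = k \<and> set is \<subseteq> {..<d}}"

definition tensor_field :: "'m mfd \<Rightarrow> nat \<Rightarrow> 'm set \<Rightarrow> ('m, real) tens \<Rightarrow> bool" where
  "tensor_field M k V \<omega> \<longleftrightarrow>
     (\<forall>c\<in>matlas M. \<forall>is\<in>idx (mdim M) k.
        smooth_on (mdim M) (snd c ` (V \<inter> fst c)) (\<lambda>x. \<omega> c (chart_inv c x) is)) \<and>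
     (\<forall>c\<in>matlas M. \<forall>c'\<in>matlas M. \<forall>p\<in>V \<inter> fst c \<inter> fst c'. \<forall>is\<in>idx (mdim M) k.
        \<omega> c p is = (\<Sum>js\<in>idx (mdim M) k.
          (\<Prod>m<k. cpd c (is ! m) (\<lambda>q. snd c' q (js ! m)) p) * \<omega> c' p js))"

definition diff_form :: "'m mfd \<Rightarrow> nat \<Rightarrow> 'm set \<Rightarrow> ('m, real) tens \<Rightarrow> bool" where
  "diff_form M k V \<omega> \<longleftrightarrow> tensor_field M k V \<omega> \<and>
     (\<forall>c\<in>matlas M. \<forall>p\<in>V \<inter> fst c. \<forall>is\<in>idx (mdim M) k. \<forall>a<k. \<forall>b<k.
        a \<noteq> b \<longrightarrow> \<omega> c p (is[a := is ! b, b := is ! a]) = - \<omega> c p is)"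

definition tens_eq :: "'m mfd \<Rightarrow> nat \<Rightarrow> 'm set \<Rightarrow> ('m, 'v) tens \<Rightarrow> ('m, 'v) tens \<Rightarrow> bool" where
  "tens_eq M k V \<omega> \<omega>' \<longleftrightarrow>
     (\<forall>c\<in>matlas M. \<forall>p\<in>V \<inter> fst c. \<forall>is\<in>idx (mdim M) k. \<omega> c p is = \<omega>' c p is)"

definition ext_d :: "('m, real) tens \<Rightarrow> ('m, real) tens" where
  "ext_d \<omega> c p is = (\<Sum>m<length is.
     (- 1) ^ m * cpd c (is ! m) (\<lambda>q. \<omega> c q (take m is @ drop (Suc m) is)) p)"

text \<open>Pull-back along F from M to N; the components do not depend on the chart of N at F p.\<close>

definition pullback :: "'m mfd \<Rightarrow> 'n mfd \<Rightarrow> ('m \<Rightarrow> 'n) \<Rightarrow> ('n, real) tens \<Rightarrow> ('m, real) tens" where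
  "pullback M N F \<omega> c p is =
     (let c' = (SOME c'. c' \<in> matlas N \<and> F p \<in> fst c') in
      \<Sum>js\<in>idx (mdim N) (length is).
        (\<Prod>m<length is. cpd c (is ! m) (\<lambda>q. snd c' (F q) (js ! m)) p) * \<omega> c' (F p) js)"

text \<open>Functions to U(1) = R/Z are represented by arbitrary real-valued functions, to be read
  modulo Z. Smoothness means that there are smooth real lifts locally, and d log f is the
  differential of these lifts.\<close>

definition smooth_U1 :: "'m mfd \<Rightarrow> 'm set \<Rightarrow> ('m \<Rightarrow> real) \<Rightarrow> bool" where
  "smooth_U1 M V f \<longleftrightarrow> (\<forall>p\<in>V. \<exists>W h. openin (mtop M) W \<and> p \<in> W \<and> W \<subseteq> V \<and>
     smooth_fun M W h \<and> (\<forall>q\<in>W. f q - h q \<in> \<int>))"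

definition is_dlog :: "'m mfd \<Rightarrow> 'm set \<Rightarrow> ('m \<Rightarrow> real) \<Rightarrow> ('m, real) tens \<Rightarrow> bool" where
  "is_dlog M V f \<alpha> \<longleftrightarrow> (\<forall>p\<in>V. \<exists>W h. openin (mtop M) W \<and> p \<in> W \<and> W \<subseteq> V \<and>
     smooth_fun M W h \<and> (\<forall>q\<in>W. f q - h q \<in> \<int>) \<and>
     tens_eq M 1 W \<alpha> (ext_d (\<lambda>c q is. h q)))"


section \<open>The Lie algebra so(n)\<close>

definition so :: "nat \<Rightarrow> real mat set" where
  "so n = {A \<in> carrier_mat n n. transpose_mat A = - A}"

definition lie :: "real mat \<Rightarrow> real mat \<Rightarrow> real mat" where
  "lie A B = A * B - B * A"

text \<open>For a curvature R with values in so(n) the class of p_1 is represented by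
  -1/(8 pi^2) tr (R R), hence the following form represents p_1/2.\<close>

definition ipg :: "nat \<Rightarrow> real mat \<Rightarrow> real mat \<Rightarrow> real" where
  "ipg n A B = - (1 / (16 * pi\<^sup>2)) * (\<Sum>i<n. (A * B) $$ (i, i))"

definition so_form :: "nat \<Rightarrow> 'm mfd \<Rightarrow> nat \<Rightarrow> 'm set \<Rightarrow> ('m, real mat) tens \<Rightarrow> bool" where
  "so_form n M k V \<theta> \<longleftrightarrow>
     (\<forall>c\<in>matlas M. \<forall>p\<in>V \<inter> fst c. \<forall>is\<in>idx (mdim M) k. \<theta> c p is \<in> so n) \<and>
     (\<forall>r<n. \<forall>s<n. diff_form M k V (\<lambda>c p is. \<theta> c p is $$ (r, s)))"

definition ext_so :: "nat \<Rightarrow> ('m, real mat) tens \<Rightarrow> ('m, real mat) tens" where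
  "ext_so n \<theta> c p is = mat n n (\<lambda>(r, s). ext_d (\<lambda>c p is. \<theta> c p is $$ (r, s)) c p is)"

text \<open>\<open>bracket1 \<theta>\<close> is the 2-form \<open>[\<theta>,\<theta>]\<close>, with \<open>[\<theta>,\<theta>](X,Y) = 2 [\<theta>(X),\<theta>(Y)]\<close>; \<open>wedge11\<close> and
  \<open>wedge12\<close> are the wedge products of forms of the given degrees, contracted by the pairing.\<close>

definition bracket1 :: "('m, real mat) tens \<Rightarrow> ('m, real mat) tens" where
  "bracket1 \<theta> c p is = 2 \<cdot>\<^sub>m lie (\<theta> c p [is ! 0]) (\<theta> c p [is ! 1])"

definition wedge11 :: "nat \<Rightarrow> ('m, real mat) tens \<Rightarrow> ('m, real mat) tens \<Rightarrow> ('m, real) tens" where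
  "wedge11 n \<alpha> \<beta> c p is =
     ipg n (\<alpha> c p [is ! 0]) (\<beta> c p [is ! 1]) - ipg n (\<alpha> c p [is ! 1]) (\<beta> c p [is ! 0])"

definition wedge12 :: "nat \<Rightarrow> ('m, real mat) tens \<Rightarrow> ('m, real mat) tens \<Rightarrow> ('m, real) tens" where
  "wedge12 n \<alpha> \<omega> c p is =
     ipg n (\<alpha> c p [is ! 0]) (\<omega> c p [is ! 1, is ! 2]) +
     ipg n (\<alpha> c p [is ! 1]) (\<omega> c p [is ! 2, is ! 0]) +
     ipg n (\<alpha> c p [is ! 2]) (\<omega> c p [is ! 0, is ! 1])"

definition cs3 :: "nat \<Rightarrow> ('m, real mat) tens \<Rightarrow> ('m, real) tens" where
  "cs3 n \<theta> c p is = wedge12 n \<theta> (ext_so n \<theta>) c p is + 1 / 3 * wedge12 n \<theta> (bracket1 \<theta>) c p is"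


section \<open>The group Spin(n)\<close>

text \<open>Spin(n) inside the Clifford algebra of R^n with e_i e_i = 1. The basis element of the
  Clifford algebra that is the product of the e_i, i in S, in increasing order, is indexed by the
  natural number whose binary digits are the characteristic function of S; so the Clifford algebra
  is \<^const>\<open>Euclidean_space\<close> (2 ^ n).\<close>

type_synonym cl = "nat \<Rightarrow> real"

definition cl_sign :: "nat \<Rightarrow> nat \<Rightarrow> real" where
  "cl_sign a b = (- 1) ^ card {(i, j). bit a i \<and> bit b j \<and> j < i}"

definition cl_mul :: "nat \<Rightarrow> cl \<Rightarrow> cl \<Rightarrow> cl" where
  "cl_mul n x y = (\<lambda>c. if c < 2 ^ n
     then \<Sum>a<2 ^ n. \<Sum>b<2 ^ n. if semiring_bit_operations_class.xor a b = c then cl_sign a b * x a * y b else 0 else 0)"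

definition cl_one :: cl where
  "cl_one = (\<lambda>a. if a = 0 then 1 else 0)"

definition cl_vec :: "nat \<Rightarrow> (nat \<Rightarrow> real) \<Rightarrow> cl" where
  "cl_vec n v = (\<lambda>a. \<Sum>i<n. if a = 2 ^ i then v i else 0)"

definition cl_rev :: "cl \<Rightarrow> cl" where
  "cl_rev x = (\<lambda>a. (- 1) ^ (card {i. bit a i} * (card {i. bit a i} - 1) div 2) * x a)"

definition Spin :: "nat \<Rightarrow> cl set" where
  "Spin n = {foldr (cl_mul n) (map (cl_vec n) vs) cl_one | vs.
     even (length vs) \<and> (\<forall>v\<in>set vs. (\<Sum>i<n. (v i)\<^sup>2) = 1)}"

text \<open>The covering homomorphism to SO(n): the reversal of g in Spin(n) is its inverse, and
  column j consists of the coordinates of the vector g e_j g^-1. The Lie algebra of Spin(n) is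
  identified with so(n) by the differential of this homomorphism.\<close>

definition rho :: "nat \<Rightarrow> cl \<Rightarrow> real mat" where
  "rho n g = mat n n (\<lambda>(i, j).
     cl_mul n (cl_mul n g (cl_vec n (\<lambda>k. if k = j then 1 else 0))) (cl_rev g) (2 ^ i))"

definition Ad :: "nat \<Rightarrow> cl \<Rightarrow> real mat \<Rightarrow> real mat" where
  "Ad n g A = rho n g * A * transpose_mat (rho n g)"

text \<open>Pull-back of the right-invariant Maurer-Cartan form along g, i.e. dg g^-1.\<close>

definition MC :: "nat \<Rightarrow> ('m \<Rightarrow> cl) \<Rightarrow> ('m, real mat) tens" where
  "MC n g c p is = mat n n (\<lambda>(r, s). cpd c (hd is) (\<lambda>q. rho n (g q) $$ (r, s)) p)
     * transpose_mat (rho n (g p))"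


section \<open>The simplicial manifold BG for G = Spin(n)\<close>

text \<open>A point of G^k is stored as the concatenation of its k blocks of length 2^n.\<close>

definition pack :: "nat \<Rightarrow> cl list \<Rightarrow> nat \<Rightarrow> real" where
  "pack n gs = (\<lambda>m. if m < length gs * 2 ^ n then (gs ! (m div 2 ^ n)) (m mod 2 ^ n) else 0)"

definition blk :: "nat \<Rightarrow> nat \<Rightarrow> (nat \<Rightarrow> real) \<Rightarrow> cl" where
  "blk n j p = (\<lambda>b. if b < 2 ^ n then p (j * 2 ^ n + b) else 0)"

definition unpack :: "nat \<Rightarrow> nat \<Rightarrow> (nat \<Rightarrow> real) \<Rightarrow> cl list" where
  "unpack n k p = map (\<lambda>j. blk n j p) [0..<k]"

definition Gpow :: "nat \<Rightarrow> nat \<Rightarrow> (nat \<Rightarrow> real) set" where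
  "Gpow n k = pack n ` {gs. length gs = k \<and> set gs \<subseteq> Spin n}"

definition faceL :: "nat \<Rightarrow> nat \<Rightarrow> cl list \<Rightarrow> cl list" where
  "faceL n i gs = (if i = 0 then tl gs else if i = length gs then butlast gs
     else take (i - 1) gs @ [cl_mul n (gs ! (i - 1)) (gs ! i)] @ drop (i + 1) gs)"

definition face :: "nat \<Rightarrow> nat \<Rightarrow> nat \<Rightarrow> (nat \<Rightarrow> real) \<Rightarrow> nat \<Rightarrow> real" where
  "face n k i p = pack n (faceL n i (unpack n k p))"

definition degen :: "nat \<Rightarrow> nat \<Rightarrow> nat \<Rightarrow> (nat \<Rightarrow> real) \<Rightarrow> nat \<Rightarrow> real" where
  "degen n k i p = pack n (take i (unpack n k p) @ [cl_one] @ drop i (unpack n k p))"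

text \<open>Smoothness on arbitrary subsets of R^N (local smooth extendability), and the maximal smooth
  atlas of an embedded d-dimensional submanifold S of R^N.\<close>

definition smooth_on_subset ::
    "nat \<Rightarrow> (nat \<Rightarrow> real) set \<Rightarrow> ((nat \<Rightarrow> real) \<Rightarrow> real) \<Rightarrow> bool" where
  "smooth_on_subset N U f \<longleftrightarrow> (\<forall>p\<in>U. \<exists>W F. openin (Euclidean_space N) W \<and> p \<in> W \<and>
     smooth_on N W F \<and> (\<forall>q\<in>W \<inter> U. F q = f q))"

definition submfd :: "nat \<Rightarrow> nat \<Rightarrow> (nat \<Rightarrow> real) set \<Rightarrow> (nat \<Rightarrow> real) mfd" where
  "submfd N d S = \<lparr>mdim = d, mtop = subtopology (Euclidean_space N) S,
     matlas = {(U, \<phi>). openin (subtopology (Euclidean_space N) S) U \<and> inj_on \<phi> U \<and>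
       openin (Euclidean_space d) (\<phi> ` U) \<and>
       (\<forall>j<d. smooth_on_subset N U (\<lambda>p. \<phi> p j)) \<and>
       (\<forall>m<N. smooth_on d (\<phi> ` U) (\<lambda>x. inv_into U \<phi> x m))}\<rparr>"

definition GM :: "nat \<Rightarrow> nat \<Rightarrow> (nat \<Rightarrow> real) mfd" where
  "GM n k = submfd (k * 2 ^ n) (k * (n * (n - 1) div 2)) (Gpow n k)"


section \<open>Presentations of String(n)\<close>

text \<open>A simplicial cover of BG, with simplicial index set \<open>sm_ix\<close> (face and degeneracy maps
  \<open>sm_fc k\<close>, \<open>sm_dg k\<close> defined in level k) and open sets \<open>sm_cv k \<alpha>\<close> of G^k, and Cech cochains
  eta in degree 2 on G, Psi in degree 1 on G^2 and Theta in degree 0 on G^3 (modulo Z).\<close>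

record 'i string_model =
  sm_ix :: "nat \<Rightarrow> 'i set"
  sm_fc :: "nat \<Rightarrow> nat \<Rightarrow> 'i \<Rightarrow> 'i"
  sm_dg :: "nat \<Rightarrow> nat \<Rightarrow> 'i \<Rightarrow> 'i"
  sm_cv :: "nat \<Rightarrow> 'i \<Rightarrow> (nat \<Rightarrow> real) set"
  sm_eta :: "'i \<Rightarrow> 'i \<Rightarrow> 'i \<Rightarrow> (nat \<Rightarrow> real) \<Rightarrow> real"
  sm_Psi :: "'i \<Rightarrow> 'i \<Rightarrow> (nat \<Rightarrow> real) \<Rightarrow> real"
  sm_Theta :: "'i \<Rightarrow> (nat \<Rightarrow> real) \<Rightarrow> real"

definition simplicial_index :: "'i string_model \<Rightarrow> bool" where
  "simplicial_index S \<longleftrightarrow>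
     (\<forall>k. \<forall>i\<le>Suc k. \<forall>\<alpha>\<in>sm_ix S (Suc k). sm_fc S (Suc k) i \<alpha> \<in> sm_ix S k) \<and>
     (\<forall>k. \<forall>i\<le>k. \<forall>\<alpha>\<in>sm_ix S k. sm_dg S k i \<alpha> \<in> sm_ix S (Suc k)) \<and>
     (\<forall>k i j. \<forall>\<alpha>\<in>sm_ix S (k + 2). i < j \<and> j \<le> k + 2 \<longrightarrow>
        sm_fc S (k + 1) i (sm_fc S (k + 2) j \<alpha>) = sm_fc S (k + 1) (j - 1) (sm_fc S (k + 2) i \<alpha>)) \<and>
     (\<forall>k i j. \<forall>\<alpha>\<in>sm_ix S k. i \<le> j \<and> j \<le> k \<longrightarrow>
        sm_dg S (k + 1) i (sm_dg S k j \<alpha>) = sm_dg S (k + 1) (j + 1) (sm_dg S k i \<alpha>)) \<and>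
     (\<forall>k j. \<forall>\<alpha>\<in>sm_ix S k. j \<le> k \<longrightarrow>
        sm_fc S (k + 1) j (sm_dg S k j \<alpha>) = \<alpha> \<and> sm_fc S (k + 1) (j + 1) (sm_dg S k j \<alpha>) = \<alpha>) \<and>
     (\<forall>k i j. \<forall>\<alpha>\<in>sm_ix S k. i < j \<and> j \<le> k \<longrightarrow>
        sm_fc S (k + 1) i (sm_dg S k j \<alpha>) = sm_dg S (k - 1) (j - 1) (sm_fc S k i \<alpha>)) \<and>
     (\<forall>k i j. \<forall>\<alpha>\<in>sm_ix S k. j + 1 < i \<and> i \<le> k + 1 \<longrightarrow>
        sm_fc S (k + 1) i (sm_dg S k j \<alpha>) = sm_dg S (k - 1) j (sm_fc S k (i - 1) \<alpha>))"

definition good_simplicial_cover :: "nat \<Rightarrow> 'i string_model \<Rightarrow> bool" where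
  "good_simplicial_cover n S \<longleftrightarrow> simplicial_index S \<and>
     (\<forall>k. \<forall>\<alpha>\<in>sm_ix S k. openin (mtop (GM n k)) (sm_cv S k \<alpha>)) \<and>
     (\<forall>k. (\<Union>\<alpha>\<in>sm_ix S k. sm_cv S k \<alpha>) = Gpow n k) \<and>
     (\<forall>k. \<forall>i\<le>Suc k. \<forall>\<alpha>\<in>sm_ix S (Suc k).
        face n (Suc k) i ` sm_cv S (Suc k) \<alpha> \<subseteq> sm_cv S k (sm_fc S (Suc k) i \<alpha>)) \<and>
     (\<forall>k. \<forall>i\<le>k. \<forall>\<alpha>\<in>sm_ix S k.
        degen n k i ` sm_cv S k \<alpha> \<subseteq> sm_cv S (Suc k) (sm_dg S k i \<alpha>)) \<and>
     (\<forall>k F. finite F \<and> F \<noteq> {} \<and> F \<subseteq> sm_ix S k \<longrightarrow>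
        contractible_space (subtopology (mtop (GM n k)) (\<Inter>\<alpha>\<in>F. sm_cv S k \<alpha>)))"

text \<open>The cocycle equations of (Theta, Psi, eta, 0). Write d for the Cech and s for the simplicial
  (alternating sum over the faces) differential. The signs d eta = 0, s eta = d Psi, s Psi = d Theta,
  s Theta = 0 are those for which, with composition
  (g_ab,x)(g_bc,y) = (g_ac, x + y - eta_abc(g)) in the groupoid Gamma[eta],
  the formula ((g_ab,x), (h_cd,y)) |-> (gh, x + y - Psi(g,h)) is a functor and Theta, added to the
  U(1)-coordinate, is a natural associator for it satisfying the pentagon identity.\<close>

definition string_cocycle :: "nat \<Rightarrow> 'i string_model \<Rightarrow> bool" where
  "string_cocycle n S \<longleftrightarrow>
     (let I = sm_ix S; V = sm_cv S; fc = sm_fc S; \<eta> = sm_eta S; \<Psi> = sm_Psi S; \<Theta> = sm_Theta S in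
     (\<forall>\<alpha>\<in>I 1. \<forall>\<beta>\<in>I 1. \<forall>\<gamma>\<in>I 1. smooth_U1 (GM n 1) (V 1 \<alpha> \<inter> V 1 \<beta> \<inter> V 1 \<gamma>) (\<eta> \<alpha> \<beta> \<gamma>)) \<and>
     (\<forall>\<alpha>\<in>I 2. \<forall>\<beta>\<in>I 2. smooth_U1 (GM n 2) (V 2 \<alpha> \<inter> V 2 \<beta>) (\<Psi> \<alpha> \<beta>)) \<and>
     (\<forall>\<alpha>\<in>I 3. smooth_U1 (GM n 3) (V 3 \<alpha>) (\<Theta> \<alpha>)) \<and>
     (\<forall>\<alpha>\<in>I 1. \<forall>\<beta>\<in>I 1. \<forall>\<gamma>\<in>I 1. \<forall>\<delta>\<in>I 1. \<forall>p\<in>V 1 \<alpha> \<inter> V 1 \<beta> \<inter> V 1 \<gamma> \<inter> V 1 \<delta>.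
        \<eta> \<beta> \<gamma> \<delta> p - \<eta> \<alpha> \<gamma> \<delta> p + \<eta> \<alpha> \<beta> \<delta> p - \<eta> \<alpha> \<beta> \<gamma> p \<in> \<int>) \<and>
     (\<forall>\<alpha>\<in>I 2. \<forall>\<beta>\<in>I 2. \<forall>\<gamma>\<in>I 2. \<forall>p\<in>V 2 \<alpha> \<inter> V 2 \<beta> \<inter> V 2 \<gamma>.
        (\<Sum>i\<le>2. (- 1) ^ i * \<eta> (fc 2 i \<alpha>) (fc 2 i \<beta>) (fc 2 i \<gamma>) (face n 2 i p))
          - (\<Psi> \<beta> \<gamma> p - \<Psi> \<alpha> \<gamma> p + \<Psi> \<alpha> \<beta> p) \<in> \<int>) \<and>
     (\<forall>\<alpha>\<in>I 3. \<forall>\<beta>\<in>I 3. \<forall>p\<in>V 3 \<alpha> \<inter> V 3 \<beta>.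
        (\<Sum>i\<le>3. (- 1) ^ i * \<Psi> (fc 3 i \<alpha>) (fc 3 i \<beta>) (face n 3 i p))
          - (\<Theta> \<beta> p - \<Theta> \<alpha> p) \<in> \<int>) \<and>
     (\<forall>\<alpha>\<in>I 4. \<forall>p\<in>V 4 \<alpha>.
        (\<Sum>i\<le>4. (- 1) ^ i * \<Theta> (fc 4 i \<alpha>) (face n 4 i p)) \<in> \<int>))"

text \<open>On BG the class of (R,R), and so the real class of p_1/2, is represented in the simplicial
  de Rham complex by the forms \<open>cartan3\<close> on G and \<open>PW2\<close> on G^2; with the conventions for cs_3 one has
  cs_3(g^-1 \<theta> g + g^-1 dg) - cs_3(\<theta>) = - d (dg g^-1, \<theta>) + g^* cartan3.\<close>

definition cartan3 :: "nat \<Rightarrow> (nat \<Rightarrow> real, real) tens" where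
  "cartan3 n c p is = - (1 / 6) * wedge12 n (MC n (blk n 0)) (bracket1 (MC n (blk n 0))) c p is"

definition PW2 :: "nat \<Rightarrow> (nat \<Rightarrow> real, real) tens" where
  "PW2 n = wedge11 n
     (\<lambda>c p is. transpose_mat (rho n (blk n 0 p)) * MC n (blk n 0) c p is * rho n (blk n 0 p))
     (MC n (blk n 1))"

definition fpull :: "nat \<Rightarrow> nat \<Rightarrow> nat \<Rightarrow> (nat \<Rightarrow> real, real) tens \<Rightarrow> (nat \<Rightarrow> real, real) tens" where
  "fpull n k i = pullback (GM n k) (GM n (k - 1)) (face n k i)"

text \<open>The cocycle (Theta, Psi, eta, 0) has class p_1/2: its d log is cohomologous to
  (0, 0, 0; PW2; cartan3) in the total complex of Cech-simplicial-de Rham cochains of BG, through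
  \<open>\<kappa>\<close> (2-forms on G), \<open>b1\<close> (Cech 1-cochain of 1-forms on G) and \<open>a1\<close> (1-forms on G^2). The
  real class determines the integral one, because H^4(BSpin(n),Z) has no torsion for n >= 3, and
  cochains of real functions need not be considered, because the smooth real group cohomology of a
  compact group vanishes. The signs are those forced by the equations of string data below.\<close>

definition represents_half_p1 :: "nat \<Rightarrow> 'i string_model \<Rightarrow> bool" where
  "represents_half_p1 n S \<longleftrightarrow>
     (let I = sm_ix S; V = sm_cv S; fc = sm_fc S in
     \<exists>\<kappa> b1 a1.
     (\<forall>\<alpha>\<in>I 1. diff_form (GM n 1) 2 (V 1 \<alpha>) (\<kappa> \<alpha>) \<and>
        tens_eq (GM n 1) 3 (V 1 \<alpha>) (ext_d (\<kappa> \<alpha>)) (cartan3 n)) \<and>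
     (\<forall>\<alpha>\<in>I 1. \<forall>\<beta>\<in>I 1. diff_form (GM n 1) 1 (V 1 \<alpha> \<inter> V 1 \<beta>) (b1 \<alpha> \<beta>) \<and>
        tens_eq (GM n 1) 2 (V 1 \<alpha> \<inter> V 1 \<beta>)
          (\<lambda>c p is. \<kappa> \<beta> c p is - \<kappa> \<alpha> c p is) (ext_d (b1 \<alpha> \<beta>))) \<and>
     (\<forall>\<alpha>\<in>I 1. \<forall>\<beta>\<in>I 1. \<forall>\<gamma>\<in>I 1.
        is_dlog (GM n 1) (V 1 \<alpha> \<inter> V 1 \<beta> \<inter> V 1 \<gamma>) (sm_eta S \<alpha> \<beta> \<gamma>)
          (\<lambda>c p is. b1 \<beta> \<gamma> c p is - b1 \<alpha> \<gamma> c p is + b1 \<alpha> \<beta> c p is)) \<and>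
     (\<forall>\<alpha>\<in>I 2. diff_form (GM n 2) 1 (V 2 \<alpha>) (a1 \<alpha>) \<and>
        tens_eq (GM n 2) 2 (V 2 \<alpha>)
          (\<lambda>c p is. PW2 n c p is + (\<Sum>i\<le>2. (- 1) ^ i * fpull n 2 i (\<kappa> (fc 2 i \<alpha>)) c p is))
          (\<lambda>c p is. - ext_d (a1 \<alpha>) c p is)) \<and>
     (\<forall>\<alpha>\<in>I 2. \<forall>\<beta>\<in>I 2.
        is_dlog (GM n 2) (V 2 \<alpha> \<inter> V 2 \<beta>) (sm_Psi S \<alpha> \<beta>)
          (\<lambda>c p is. a1 \<beta> c p is - a1 \<alpha> c p is
             + (\<Sum>i\<le>2. (- 1) ^ i * fpull n 2 i (b1 (fc 2 i \<alpha>) (fc 2 i \<beta>)) c p is))) \<and>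
     (\<forall>\<alpha>\<in>I 3.
        is_dlog (GM n 3) (V 3 \<alpha>) (sm_Theta S \<alpha>)
          (\<lambda>c p is. \<Sum>i\<le>3. (- 1) ^ i * fpull n 3 i (a1 (fc 3 i \<alpha>)) c p is)))"

definition string_presentation :: "nat \<Rightarrow> 'i string_model \<Rightarrow> bool" where
  "string_presentation n S \<longleftrightarrow>
     good_simplicial_cover n S \<and> string_cocycle n S \<and> represents_half_p1 n S"


section \<open>String data\<close>

text \<open>A trivialized principal Gamma[eta]-bundle g_ij over U_ij is a smooth map to the objects of
  Gamma[eta], i.e. an index \<open>sd_ix i j\<close> together with a smooth map \<open>sd_g i j\<close> from U_ij to the open
  set of G with this index. Likewise the product g_ij g_jk is trivialized over U_ijk by an index
  \<open>sd_ix2 i j k\<close> of an open set of G^2 containing the image of (g_ij, g_jk); with respect to these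
  trivializations the isomorphism from g_ik to g_ij g_jk is the U(1)-valued function \<open>sd_f i j k\<close>.\<close>

record ('k, 'i, 'm) string_data =
  sd_U :: "'k \<Rightarrow> 'm set"
  sd_theta :: "'k \<Rightarrow> ('m, real mat) tens"
  sd_B :: "'k \<Rightarrow> ('m, real) tens"
  sd_ix :: "'k \<Rightarrow> 'k \<Rightarrow> 'i"
  sd_g :: "'k \<Rightarrow> 'k \<Rightarrow> 'm \<Rightarrow> cl"
  sd_A :: "'k \<Rightarrow> 'k \<Rightarrow> ('m, real) tens"
  sd_w2 :: "'k \<Rightarrow> 'k \<Rightarrow> ('m, real) tens"
  sd_ix2 :: "'k \<Rightarrow> 'k \<Rightarrow> 'k \<Rightarrow> 'i"
  sd_f :: "'k \<Rightarrow> 'k \<Rightarrow> 'k \<Rightarrow> 'm \<Rightarrow> real"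
  sd_w1 :: "'k \<Rightarrow> 'k \<Rightarrow> 'k \<Rightarrow> ('m, real) tens"

text \<open>In the trivialization (g_{a b}, 0) the bundle g_ij with index a has transition arrows
  (g_{b c}, eta_{a b c}(g)). Hence if g_ij g_jk is trivialized by the index s instead of
  \<open>sd_ix2 i j k\<close> (and its factors and g_ik by the faces of s), the function f_ijk
  changes by the following summand.\<close>

definition change_triv ::
    "nat \<Rightarrow> 'i string_model \<Rightarrow> ('k, 'i, 'm) string_data \<Rightarrow> 'k \<Rightarrow> 'k \<Rightarrow> 'k \<Rightarrow> 'i \<Rightarrow> 'm \<Rightarrow> real" where
  "change_triv n S P i j k s p =
     (let \<sigma> = sd_ix2 P i j k;
          t = (\<lambda>i j m. sm_eta S (sd_ix P i j) (sm_fc S 2 m \<sigma>) (sm_fc S 2 m s) (pack n [sd_g P i j p]))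
      in sm_Psi S \<sigma> s (pack n [sd_g P i j p, sd_g P j k p]) - (t j k 0 - t i k 1 + t i j 2))"

text \<open>The pentagon condition reads \<open>\<delta>f = F\<close>. The associator is the function Theta_s in the
  trivializations given by the faces of an index s of level 3; F refers it to the chosen
  trivializations. By the cocycle equations F does not depend on s.\<close>

definition assoc_fun :: "nat \<Rightarrow> 'i string_model \<Rightarrow> ('k, 'i, 'm) string_data
    \<Rightarrow> 'k \<Rightarrow> 'k \<Rightarrow> 'k \<Rightarrow> 'k \<Rightarrow> 'i \<Rightarrow> 'm \<Rightarrow> real" where
  "assoc_fun n S P i j k l s p =
     sm_Theta S s (pack n [sd_g P i j p, sd_g P j k p, sd_g P k l p])
     - (change_triv n S P j k l (sm_fc S 3 0 s) p - change_triv n S P i k l (sm_fc S 3 1 s) p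
        + change_triv n S P i j l (sm_fc S 3 2 s) p - change_triv n S P i j k (sm_fc S 3 3 s) p)"

definition open_cover :: "'m mfd \<Rightarrow> ('k \<Rightarrow> 'm set) \<Rightarrow> bool" where
  "open_cover M U \<longleftrightarrow> (\<forall>i. openin (mtop M) (U i)) \<and> (\<Union>i. U i) = topspace (mtop M)"

definition string_data ::
    "nat \<Rightarrow> 'i string_model \<Rightarrow> 'm mfd \<Rightarrow> ('k, 'i, 'm) string_data \<Rightarrow> bool" where
  "string_data n S M P \<longleftrightarrow>
     (let U = sd_U P; \<theta> = sd_theta P; B = sd_B P; g = sd_g P; A = sd_A P; w2 = sd_w2 P;
          f = sd_f P; w1 = sd_w1 P in
     open_cover M U \<and>
     (\<forall>i. so_form n M 1 (U i) (\<theta> i) \<and> diff_form M 2 (U i) (B i)) \<and>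
     (\<forall>i j.
        (\<forall>p\<in>U i \<inter> U j. g i j p \<in> Spin n) \<and>
        (\<forall>b<2 ^ n. smooth_fun M (U i \<inter> U j) (\<lambda>p. g i j p b)) \<and>
        sd_ix P i j \<in> sm_ix S 1 \<and>
        (\<forall>p\<in>U i \<inter> U j. pack n [g i j p] \<in> sm_cv S 1 (sd_ix P i j)) \<and>
        diff_form M 1 (U i \<inter> U j) (A i j) \<and>
        diff_form M 2 (U i \<inter> U j) (w2 i j) \<and>
        tens_eq M 2 (U i \<inter> U j)
          (\<lambda>c p is. B j c p is - B i c p is) (\<lambda>c p is. ext_d (A i j) c p is + w2 i j c p is) \<and>
        tens_eq M 3 (U i \<inter> U j)
          (\<lambda>c p is. cs3 n (\<theta> j) c p is - cs3 n (\<theta> i) c p is) (ext_d (w2 i j)) \<and>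
        tens_eq M 1 (U i \<inter> U j)
          (\<lambda>c p is. \<theta> i c p is - Ad n (g i j p) (\<theta> j c p is)) (\<lambda>c p is. - MC n (g i j) c p is)) \<and>
     (\<forall>i j k.
        sd_ix2 P i j k \<in> sm_ix S 2 \<and>
        (\<forall>p\<in>U i \<inter> U j \<inter> U k.
           pack n [g i j p, g j k p] \<in> sm_cv S 2 (sd_ix2 P i j k) \<and>
           cl_mul n (g i j p) (g j k p) = g i k p) \<and>
        smooth_U1 M (U i \<inter> U j \<inter> U k) (f i j k) \<and>
        diff_form M 1 (U i \<inter> U j \<inter> U k) (w1 i j k) \<and>
        is_dlog M (U i \<inter> U j \<inter> U k) (f i j k)
          (\<lambda>c p is. w1 i j k c p is - (A j k c p is - A i k c p is + A i j c p is)) \<and>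
        tens_eq M 2 (U i \<inter> U j \<inter> U k)
          (\<lambda>c p is. w2 j k c p is - w2 i k c p is + w2 i j c p is)
          (\<lambda>c p is. - ext_d (w1 i j k) c p is)) \<and>
     (\<forall>i j k l. \<forall>p\<in>U i \<inter> U j \<inter> U k \<inter> U l. \<forall>s\<in>sm_ix S 3.
        pack n [g i j p, g j k p, g k l p] \<in> sm_cv S 3 s \<longrightarrow>
        (f j k l p - f i k l p + f i j l p - f i j k p) - assoc_fun n S P i j k l s p \<in> \<int>))"


section \<open>Transitive Courant data\<close>

text \<open>Elements and sections of the standard transitive Courant algebroid, in components.\<close>

type_synonym elt = "(nat \<Rightarrow> real) \<times> real mat \<times> (nat \<Rightarrow> real)"

type_synonym 'm sect = "'m chart \<Rightarrow> 'm \<Rightarrow> elt"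

definition elt_eq :: "nat \<Rightarrow> elt \<Rightarrow> elt \<Rightarrow> bool" where
  "elt_eq d e e' \<longleftrightarrow> (\<forall>i<d. fst e i = fst e' i) \<and> fst (snd e) = fst (snd e') \<and>
     (\<forall>i<d. snd (snd e) i = snd (snd e') i)"

definition is_section :: "nat \<Rightarrow> 'm mfd \<Rightarrow> 'm set \<Rightarrow> 'm sect \<Rightarrow> bool" where
  "is_section n M V e \<longleftrightarrow>
     (\<forall>c\<in>matlas M. \<forall>i<mdim M.
        smooth_on (mdim M) (snd c ` (V \<inter> fst c)) (\<lambda>x. fst (e c (chart_inv c x)) i)) \<and>
     (\<forall>c\<in>matlas M. \<forall>c'\<in>matlas M. \<forall>p\<in>V \<inter> fst c \<inter> fst c'. \<forall>j<mdim M.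
        fst (e c' p) j = (\<Sum>i<mdim M. cpd c i (\<lambda>q. snd c' q j) p * fst (e c p) i)) \<and>
     so_form n M 0 V (\<lambda>c p is. fst (snd (e c p))) \<and>
     diff_form M 1 V (\<lambda>c p is. snd (snd (e c p)) (hd is))"

definition pairing :: "nat \<Rightarrow> nat \<Rightarrow> elt \<Rightarrow> elt \<Rightarrow> real" where
  "pairing n d e e' = (case e of (X, a, \<xi>) \<Rightarrow> case e' of (Y, b, \<eta>) \<Rightarrow>
     1 / 2 * ((\<Sum>i<d. \<xi> i * Y i) + (\<Sum>i<d. \<eta> i * X i)) + ipg n a b)"

definition cbracket :: "nat \<Rightarrow> nat \<Rightarrow> 'm sect \<Rightarrow> 'm sect \<Rightarrow> 'm sect" where
  "cbracket n d e e' c p =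
     (let X = (\<lambda>q. fst (e c q)); a = (\<lambda>q. fst (snd (e c q))); \<xi> = (\<lambda>q. snd (snd (e c q)));
          Y = (\<lambda>q. fst (e' c q)); b = (\<lambda>q. fst (snd (e' c q))); \<eta> = (\<lambda>q. snd (snd (e' c q)));
          Dmat = (\<lambda>i h. mat n n (\<lambda>(r, s). cpd c i (\<lambda>q. h q $$ (r, s)) p))
      in
      (\<lambda>i. \<Sum>j<d. X p j * cpd c j (\<lambda>q. Y q i) p - Y p j * cpd c j (\<lambda>q. X q i) p,
       mat n n (\<lambda>(r, s). \<Sum>j<d. X p j * Dmat j b $$ (r, s) - Y p j * Dmat j a $$ (r, s))
         + lie (a p) (b p),
       \<lambda>i. (\<Sum>j<d. X p j * cpd c j (\<lambda>q. \<eta> q i) p + \<eta> p j * cpd c i (\<lambda>q. X q j) p)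
         - (\<Sum>j<d. Y p j * (cpd c j (\<lambda>q. \<xi> q i) p - cpd c i (\<lambda>q. \<xi> q j) p))
         + 2 * ipg n (b p) (Dmat i a)))"

text \<open>The triple \<open>(\<phi>,\<tau>,\<beta>)\<close> stands for the lower triangular matrix with rows (1,0,0),
  \<open>(\<phi>,\<tau>,0)\<close> and \<open>(\<beta>,-2\<phi>\<^sup>\<star>\<tau>,1)\<close>; the components of \<open>\<beta>\<close> are \<open>\<beta>(X)(Y)\<close> for X, Y the coordinate fields,
  and \<open>\<beta>\<close> need not be skew.\<close>

type_synonym 'm triple =
  "('m, real mat) tens \<times> ('m \<Rightarrow> real mat \<Rightarrow> real mat) \<times> ('m, real) tens"

definition apply_triple :: "nat \<Rightarrow> nat \<Rightarrow> 'm triple \<Rightarrow> 'm chart \<Rightarrow> 'm \<Rightarrow> elt \<Rightarrow> elt" where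
  "apply_triple n d L c p e = (case L of (\<phi>, \<tau>, \<beta>) \<Rightarrow> case e of (X, a, \<xi>) \<Rightarrow>
     (X,
      mat n n (\<lambda>(r, s). \<Sum>i<d. X i * \<phi> c p [i] $$ (r, s)) + \<tau> p a,
      \<lambda>j. (\<Sum>i<d. X i * \<beta> c p [i, j]) - 2 * ipg n (\<tau> p a) (\<phi> c p [j]) + \<xi> j))"

definition lie_automorphism_field ::
    "nat \<Rightarrow> 'm mfd \<Rightarrow> 'm set \<Rightarrow> ('m \<Rightarrow> real mat \<Rightarrow> real mat) \<Rightarrow> bool" where
  "lie_automorphism_field n M V \<tau> \<longleftrightarrow>
     (\<forall>p\<in>V. bij_betw (\<tau> p) (so n) (so n) \<and>
        (\<forall>a\<in>so n. \<forall>b\<in>so n. \<tau> p (a + b) = \<tau> p a + \<tau> p b \<and>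
           \<tau> p (lie a b) = lie (\<tau> p a) (\<tau> p b) \<and>
           ipg n (\<tau> p a) (\<tau> p b) = ipg n a b) \<and>
        (\<forall>a\<in>so n. \<forall>x. \<tau> p (x \<cdot>\<^sub>m a) = x \<cdot>\<^sub>m \<tau> p a)) \<and>
     (\<forall>a\<in>so n. \<forall>r<n. \<forall>s<n. smooth_fun M V (\<lambda>p. \<tau> p a $$ (r, s)))"

definition courant_automorphism :: "nat \<Rightarrow> 'm mfd \<Rightarrow> 'm set \<Rightarrow> 'm triple \<Rightarrow> bool" where
  "courant_automorphism n M V L \<longleftrightarrow> (case L of (\<phi>, \<tau>, \<beta>) \<Rightarrow>
     so_form n M 1 V \<phi> \<and> lie_automorphism_field n M V \<tau> \<and> tensor_field M 2 V \<beta> \<and>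
     (\<forall>e e'. is_section n M V e \<and> is_section n M V e' \<longrightarrow>
        (\<forall>c\<in>matlas M. \<forall>p\<in>V \<inter> fst c.
           pairing n (mdim M) (apply_triple n (mdim M) L c p (e c p))
               (apply_triple n (mdim M) L c p (e' c p))
             = pairing n (mdim M) (e c p) (e' c p) \<and>
           elt_eq (mdim M)
             (apply_triple n (mdim M) L c p (cbracket n (mdim M) e e' c p))
             (cbracket n (mdim M) (\<lambda>c q. apply_triple n (mdim M) L c q (e c q))
               (\<lambda>c q. apply_triple n (mdim M) L c q (e' c q)) c p))))"

text \<open>1-morphisms from \<open>(\<theta>',B')\<close> to \<open>(\<theta>,B)\<close> over V.\<close>

definition one_morphism :: "nat \<Rightarrow> 'm mfd \<Rightarrow> 'm set \<Rightarrow> 'm triple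
    \<Rightarrow> ('m, real mat) tens \<Rightarrow> ('m, real) tens \<Rightarrow> ('m, real mat) tens \<Rightarrow> ('m, real) tens \<Rightarrow> bool" where
  "one_morphism n M V L \<theta>' B' \<theta> B \<longleftrightarrow> courant_automorphism n M V L \<and>
     (case L of (\<phi>, \<tau>, \<beta>) \<Rightarrow>
     tens_eq M 1 V \<theta> (\<lambda>c p is. \<tau> p (\<theta>' c p is) + \<phi> c p is) \<and>
     (\<forall>c\<in>matlas M. \<forall>p\<in>V \<inter> fst c. \<forall>x<mdim M. \<forall>y<mdim M.
        B' c p [x, y] - B c p [x, y] = \<beta> c p [x, y]
          + ipg n (\<theta> c p [y]) (\<theta> c p [x]) - ipg n (\<theta>' c p [y]) (\<theta>' c p [x])
          - 2 * ipg n (\<tau> p (\<theta>' c p [x])) (\<phi> c p [y])) \<and>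
     tens_eq M 3 V (\<lambda>c p is. cs3 n \<theta>' c p is - cs3 n \<theta> c p is)
       (ext_d (\<lambda>c p is. B' c p is - B c p is)))"

text \<open>L1 L2 = L3 L4 over V, as bundle maps.\<close>

definition triple_comp_eq ::
    "nat \<Rightarrow> 'm mfd \<Rightarrow> 'm set \<Rightarrow> 'm triple \<Rightarrow> 'm triple \<Rightarrow> 'm triple \<Rightarrow> 'm triple \<Rightarrow> bool" where
  "triple_comp_eq n M V L1 L2 L3 L4 \<longleftrightarrow>
     (\<forall>c\<in>matlas M. \<forall>p\<in>V \<inter> fst c. \<forall>X \<xi>. \<forall>a\<in>so n. elt_eq (mdim M)
        (apply_triple n (mdim M) L1 c p (apply_triple n (mdim M) L2 c p (X, a, \<xi>)))
        (apply_triple n (mdim M) L3 c p (apply_triple n (mdim M) L4 c p (X, a, \<xi>))))"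

definition triple_id :: "nat \<Rightarrow> 'm triple" where
  "triple_id n = (\<lambda>c p is. 0\<^sub>m n n, \<lambda>p a. a, \<lambda>c p is. 0)"

record ('k, 'm) courant_data =
  cd_U :: "'k \<Rightarrow> 'm set"
  cd_theta :: "'k \<Rightarrow> ('m, real mat) tens"
  cd_B :: "'k \<Rightarrow> ('m, real) tens"
  cd_L :: "'k \<Rightarrow> 'k \<Rightarrow> 'm triple"

definition courant_data :: "nat \<Rightarrow> 'm mfd \<Rightarrow> ('k, 'm) courant_data \<Rightarrow> bool" where
  "courant_data n M T \<longleftrightarrow>
     (let U = cd_U T; \<theta> = cd_theta T; B = cd_B T; L = cd_L T in
     open_cover M U \<and>
     (\<forall>i. so_form n M 1 (U i) (\<theta> i) \<and> diff_form M 2 (U i) (B i)) \<and>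
     (\<forall>i j. one_morphism n M (U i \<inter> U j) (L i j) (\<theta> j) (B j) (\<theta> i) (B i)) \<and>
     (\<forall>i j k. triple_comp_eq n M (U i \<inter> U j \<inter> U k) (L i j) (L j k) (L i k) (triple_id n)))"

text \<open>Isomorphisms from T' to T over a common refinement of the covers U of T and U' of T'; a
  member of the refinement is a triple (i, j, W) with W contained in U i and U' j.\<close>

definition courant_iso ::
    "nat \<Rightarrow> 'm mfd \<Rightarrow> ('j, 'm) courant_data \<Rightarrow> ('k, 'm) courant_data \<Rightarrow> bool" where
  "courant_iso n M T' T \<longleftrightarrow>
     (\<exists>(R :: ('k \<times> 'j \<times> 'm set) set) L.
       (\<Union>(i, j, W)\<in>R. W) = topspace (mtop M) \<and>
       (\<forall>(i, j, W)\<in>R. openin (mtop M) W \<and> W \<subseteq> cd_U T i \<inter> cd_U T' j \<and>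
          one_morphism n M W (L (i, j, W)) (cd_theta T' j) (cd_B T' j) (cd_theta T i) (cd_B T i)) \<and>
       (\<forall>(i1, j1, W1)\<in>R. \<forall>(i2, j2, W2)\<in>R.
          triple_comp_eq n M (W1 \<inter> W2)
            (cd_L T i1 i2) (L (i2, j2, W2)) (L (i1, j1, W1)) (cd_L T' j1 j2)))"


section \<open>The map Phi on objects\<close>

definition Phi :: "nat \<Rightarrow> ('k, 'i, 'm) string_data \<Rightarrow> ('k, 'm) courant_data" where
  "Phi n P = \<lparr>cd_U = sd_U P, cd_theta = sd_theta P, cd_B = sd_B P,
     cd_L = (\<lambda>i j. let \<mu> = MC n (sd_g P i j); \<theta> = sd_theta P i in
       (\<lambda>c p is. - \<mu> c p is,
        \<lambda>p a. Ad n (sd_g P i j p) a,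
        \<lambda>c p is. ext_d (sd_A P i j) c p is + sd_w2 P i j c p is
          + ipg n (\<mu> c p [is ! 0]) (\<theta> c p [is ! 1])
          - ipg n (\<mu> c p [is ! 1]) (\<theta> c p [is ! 0])
          - ipg n (\<mu> c p [is ! 0]) (\<mu> c p [is ! 1])))\<rparr>"

end

theory Submission
  imports Defs "Jordan_Normal_Form.Determinant"
begin

text \<open>The obstruction is an outer automorphism of so(4). On so(n) with n even, conjugation by a
  reflection has determinant -1, while Ad g has determinant 1 for all g in Spin(n). Hence the
  determinants of the \<open>\<tau>\<^sub>i\<^sub>j\<close> of transitive Courant data form a cocycle with values in {1,-1}, whose
  class in H^1(M, Z/2) is invariant under isomorphisms and vanishes on the image of Phi. On the
  punctured plane every such class is realized by flat data (\<open>\<theta> = 0\<close>, \<open>B = 0\<close>, \<open>\<phi> = 0\<close>, \<open>\<beta> = 0\<close>)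
  with locally constant \<open>\<tau>\<^sub>i\<^sub>j\<close>, and the nontrivial class gives the example.\<close>

section \<open>Half-turns\<close>

text \<open>The value 1 of the determinant of \<open>Ad 4 g\<close> comes from algebra, not from
  connectedness of the group: \<open>Spin n\<close> is given by words of even length in unit
  vectors, every unit vector acts by a half-turn, any two half-turns are equal or conjugate, so all
  have one determinant, of square 1, and an even number of them cancels. The local isomorphisms, in
  contrast, are arbitrary; of their determinants only continuity and absence of zeros enter. An
  isomorphism with an image under \<open>Phi\<close> would thus give a nowhere zero section of the
  real line bundle with the given signs as transition functions, which is the Moebius bundle.
  Dimension 4 is the least even one that is at least 3; there the determinant is that of a 6 by 6
  matrix. Flat data suffice because the signs are locally constant: no derivative of \<tau> arises
  that a nonzero \<phi> would have to absorb.\<close>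

text \<open>In the Clifford algebra, for a unit vector v, this is the map w |-> v w v, the negative of the
  reflection along v. The sign cancels in Spin(n), where only products of an even number occur.\<close>

definition half_turn :: "nat \<Rightarrow> (nat \<Rightarrow> real) \<Rightarrow> real mat" where
  "half_turn n v = mat n n (\<lambda>(i, j). 2 * v i * v j - (if i = j then 1 else 0))"

lemma half_turn_carrier [simp]: "half_turn n v \<in> carrier_mat n n"
  by (simp add: half_turn_def)

lemma half_turns_carrier [simp]: "foldr (*) (map (half_turn n) vs) (1\<^sub>m n) \<in> carrier_mat n n"
  by (induction vs) (auto intro!: mult_carrier_mat[of _ n n])

text \<open>In this form, column by column, the half-turn is met again in the Clifford algebra, see
  \<open>cl_vec_conjugation\<close>.\<close>

lemma half_turn_mult_index:
  assumes "A \<in> carrier_mat n n" "i < n" "j < n"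
  shows "(half_turn n v * A) $$ (i, j) = 2 * (\<Sum>k<n. v k * A $$ (k, j)) * v i - A $$ (i, j)"
proof -
  have "(half_turn n v * A) $$ (i, j) = (\<Sum>k<n. (2 * v i * v k - (if i = k then 1 else 0)) * A $$ (k, j))"
    using assms by (simp add: half_turn_def scalar_prod_def atLeast0LessThan)
  also have "\<dots> = (\<Sum>k<n. 2 * v i * v k * A $$ (k, j)) - (\<Sum>k<n. if i = k then A $$ (k, j) else 0)"
    by (subst sum_subtractf[symmetric], rule sum.cong) (auto simp: left_diff_distrib)
  also have "\<dots> = 2 * (\<Sum>k<n. v k * A $$ (k, j)) * v i - A $$ (i, j)"
    using assms by (simp add: sum_distrib_left sum_distrib_right mult_ac)
  finally show ?thesis .
qed

lemma half_turn_square: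
  assumes "(\<Sum>i<n. (v i)\<^sup>2) = 1"
  shows "half_turn n v * half_turn n v = 1\<^sub>m n"
proof (rule eq_matI)
  fix i j assume ij: "i < dim_row (1\<^sub>m n :: real mat)" "j < dim_col (1\<^sub>m n :: real mat)"
  have "(\<Sum>k<n. v k * half_turn n v $$ (k, j)) = (\<Sum>k<n. 2 * (v k)\<^sup>2 * v j - (if k = j then v k else 0))"
    using ij by (intro sum.cong) (auto simp: half_turn_def algebra_simps power2_eq_square)
  also have "\<dots> = v j"
    using ij assms by (simp add: sum_subtractf flip: sum_distrib_left sum_distrib_right)
  finally show "(half_turn n v * half_turn n v) $$ (i, j) = 1\<^sub>m n $$ (i, j)"
    using ij by (simp add: half_turn_mult_index del: index_mult_mat(1)) (simp add: half_turn_def)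
qed (simp_all add: half_turn_def)

text \<open>The half-turn about the bisector of u and v exchanges u and v, so it conjugates one
  half-turn into the other; being its own inverse it stands on both sides. For v = -u there is no
  bisector, but \<open>half_turn\<close> is even in the vector.\<close>

lemma half_turn_conjugate:
  assumes "(\<Sum>i<n. (u i)\<^sup>2) = 1" "(\<Sum>i<n. (v i)\<^sup>2) = 1"
  obtains w where "(\<Sum>i<n. (w i)\<^sup>2) = 1"
    "half_turn n v = half_turn n w * half_turn n u * half_turn n w"
    | "half_turn n v = half_turn n u"
proof (cases "\<forall>i<n. u i + v i = 0")
  case True
  then have "v i = - u i" if "i < n" for i using that by (simp add: add_eq_0_iff)
  then have "half_turn n v = half_turn n u" by (intro eq_matI) (auto simp: half_turn_def)
  then show ?thesis using that by blast
next
  case False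
  define s where "s = (\<Sum>i<n. (u i + v i)\<^sup>2)"
  define w where "w i = (u i + v i) / sqrt s" for i \<comment> \<open>the bisector of u and v\<close>
  have "s > 0" using False unfolding s_def by (auto intro!: sum_pos2)
  have ww: "(\<Sum>i<n. (w i)\<^sup>2) = 1"
    using \<open>s > 0\<close> by (simp add: w_def power_divide sum_divide_distrib[symmetric]) (simp add: s_def)
  \<comment> \<open>Both sides are 2 + 2 u.v for unit vectors. Hence \<open>wu\<close>, which says
    that the half-turn about w sends u to v.\<close>
  have "2 * (\<Sum>k<n. (u k + v k) * u k) = s"
  proof -
    have "2 * (\<Sum>k<n. (u k + v k) * u k) - s = (\<Sum>k<n. (u k)\<^sup>2) - (\<Sum>k<n. (v k)\<^sup>2)"
      unfolding s_def sum_distrib_left sum_subtractf[symmetric]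
      by (rule sum.cong) (auto simp: power2_eq_square algebra_simps)
    then show ?thesis using assms by simp
  qed
  then have wu: "2 * (\<Sum>k<n. w k * u k) * w i = u i + v i" for i
    using \<open>s > 0\<close> by (simp add: w_def sum_divide_distrib[symmetric] sum_distrib_left[symmetric])
  let ?W = "half_turn n w" and ?U = "half_turn n u" and ?V = "half_turn n v"
  have "?W * ?U = ?V * ?W"
  proof (rule eq_matI)
    fix i j assume "i < dim_row (?V * ?W)" "j < dim_col (?V * ?W)"
    then have ij: "i < n" "j < n" by (simp_all add: half_turn_def)
    have "(\<Sum>k<n. w k * ?U $$ (k, j)) = 2 * (\<Sum>k<n. w k * u k) * u j - w j"
    proof -
      have "(\<Sum>k<n. w k * ?U $$ (k, j)) = (\<Sum>k<n. 2 * (w k * u k) * u j - (if k = j then w k else 0))"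
        using ij by (intro sum.cong) (auto simp: half_turn_def algebra_simps)
      then show ?thesis
        using ij by (simp add: sum_subtractf sum_distrib_left sum_distrib_right)
    qed
    then have 1: "(?W * ?U) $$ (i, j) = (u i + v i) * (u j) * 2 - 2 * w i * w j - ?U $$ (i, j)"
      using ij by (simp add: half_turn_mult_index del: index_mult_mat(1)) (simp add: algebra_simps flip: wu)
    \<comment> \<open>The products v.w and w.u differ by a multiple of the difference of the squared
      lengths, that is by 0. So the half-turn about w also sends v back to u.\<close>
    have vw: "2 * (\<Sum>k<n. v k * w k) * w j = u j + v j"
    proof -
      have "(\<Sum>k<n. v k * w k) - (\<Sum>k<n. w k * u k) = ((\<Sum>k<n. (v k)\<^sup>2) - (\<Sum>k<n. (u k)\<^sup>2)) / sqrt s"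
        unfolding w_def sum_subtractf[symmetric] sum_divide_distrib
        by (rule sum.cong) (auto simp: power2_eq_square diff_divide_distrib algebra_simps
            simp flip: add_divide_distrib)
      then show ?thesis using assms wu[of j] by simp
    qed
    have "(\<Sum>k<n. v k * ?W $$ (k, j)) = 2 * (\<Sum>k<n. v k * w k) * w j - v j"
    proof -
      have "(\<Sum>k<n. v k * ?W $$ (k, j)) = (\<Sum>k<n. 2 * (v k * w k) * w j - (if k = j then v k else 0))"
        using ij by (intro sum.cong) (auto simp: half_turn_def algebra_simps)
      then show ?thesis
        using ij by (simp add: sum_subtractf sum_distrib_left sum_distrib_right)
    qed
    then have "(\<Sum>k<n. v k * ?W $$ (k, j)) = u j" using vw by simp
    then have 2: "(?V * ?W) $$ (i, j) = 2 * u j * v i - ?W $$ (i, j)"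
      using ij by (simp add: half_turn_mult_index del: index_mult_mat(1))
    show "(?W * ?U) $$ (i, j) = (?V * ?W) $$ (i, j)"
      unfolding 1 2 using ij by (auto simp: half_turn_def algebra_simps)
  qed (simp_all add: half_turn_def)
  then have "?W * ?U * ?W = ?V * (?W * ?W)"
    by (simp add: assoc_mult_mat[of _ n n _ n _ n])
  then have "?V = ?W * ?U * ?W"
    using half_turn_square[OF ww] by (simp add: right_mult_one_mat[of _ n n])
  then show ?thesis using that ww by blast
qed

section \<open>The determinant of an automorphism of so(4)\<close>

text \<open>The three pairs containing 0 come first, so that the matrix of \<open>axis_flip\<close>
  is diagonal with its three entries \<open>e\<close> in front.\<close>

definition so4_pair :: "nat \<Rightarrow> nat \<times> nat" where
  "so4_pair k = [(0, 1), (0, 2), (0, 3), (1, 2), (1, 3), (2, 3)] ! k"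

definition so4_basis :: "nat \<Rightarrow> real mat" where
  "so4_basis l = mat 4 4 (\<lambda>(r, s). if (r, s) = so4_pair l then 1 else if (s, r) = so4_pair l then - 1 else 0)"

definition so4_matrix :: "(real mat \<Rightarrow> real mat) \<Rightarrow> real mat" where
  "so4_matrix \<tau> = mat 6 6 (\<lambda>(k, l). \<tau> (so4_basis l) $$ so4_pair k)"

text \<open>Automorphism fields are functions on all matrices but are controlled only on
  \<open>so n\<close>; linearity has to be relative to that set.\<close>

definition so_linear :: "nat \<Rightarrow> (real mat \<Rightarrow> real mat) \<Rightarrow> bool" where
  "so_linear n \<tau> \<longleftrightarrow> \<tau> \<in> so n \<rightarrow> so n \<and> (\<forall>a\<in>so n. \<forall>b\<in>so n. \<tau> (a + b) = \<tau> a + \<tau> b) \<and>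
     (\<forall>a\<in>so n. \<forall>x. \<tau> (x \<cdot>\<^sub>m a) = x \<cdot>\<^sub>m \<tau> a)"

lemma less_4_cases: "i < 4 \<longleftrightarrow> i = 0 \<or> i = 1 \<or> i = 2 \<or> i = (3 :: nat)"
  by auto

lemma less_6_cases: "i < 6 \<longleftrightarrow> i = 0 \<or> i = 1 \<or> i = 2 \<or> i = 3 \<or> i = 4 \<or> i = (5 :: nat)"
  by auto

lemma so_carrier: "a \<in> so n \<Longrightarrow> a \<in> carrier_mat n n"
  by (simp add: so_def)

lemma so_skew:
  assumes "a \<in> so n" "r < n" "s < n"
  shows "a $$ (s, r) = - a $$ (r, s)"
proof -
  have "transpose_mat a $$ (r, s) = (- a) $$ (r, s)" using assms by (simp add: so_def)
  then show ?thesis using assms so_carrier[OF assms(1)] by simp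
qed

lemma soI:
  assumes "a \<in> carrier_mat n n" "\<And>r s. r < n \<Longrightarrow> s < n \<Longrightarrow> a $$ (s, r) = - a $$ (r, s)"
  shows "a \<in> so n"
proof -
  have "transpose_mat a = - a"
  proof (rule eq_matI)
    fix r s assume "r < dim_row (- a)" "s < dim_col (- a)"
    then have rs: "r < n" "s < n" using assms(1) by simp_all
    show "transpose_mat a $$ (r, s) = (- a) $$ (r, s)"
      using assms(2)[OF rs] assms(1) rs by simp
  qed (use assms(1) in simp_all)
  then show ?thesis using assms(1) by (simp add: so_def)
qed

lemma so_add: "a \<in> so n \<Longrightarrow> b \<in> so n \<Longrightarrow> a + b \<in> so n"
proof (rule soI)
  fix r s assume *: "a \<in> so n" "b \<in> so n" "r < n" "s < n"
  then show "(a + b) $$ (s, r) = - (a + b) $$ (r, s)"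
    using so_skew[OF *(1,3,4)] so_skew[OF *(2,3,4)] so_carrier[of a n] so_carrier[of b n] by simp
qed (auto dest: so_carrier)

lemma so_smult: "a \<in> so n \<Longrightarrow> x \<cdot>\<^sub>m a \<in> so n"
proof (rule soI)
  fix r s assume *: "a \<in> so n" "r < n" "s < n"
  then show "(x \<cdot>\<^sub>m a) $$ (s, r) = - (x \<cdot>\<^sub>m a) $$ (r, s)"
    using so_skew[OF *] so_carrier[of a n] by simp
qed (auto dest: so_carrier)

lemma so4_basis_so: "l < 6 \<Longrightarrow> so4_basis l \<in> so 4"
  by (rule soI) (auto simp: so4_basis_def so4_pair_def less_6_cases)

lemma so4_pair_less: "k < 6 \<Longrightarrow> fst (so4_pair k) < 4" "k < 6 \<Longrightarrow> snd (so4_pair k) < 4"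
  by (auto simp: so4_pair_def less_6_cases)

text \<open>The sum is nested to the right, as in \<open>sum_lessThan_6\<close>, so that a map
  linear on \<open>so 4\<close> can be applied to one summand after the other.\<close>

lemma so4_expand:
  assumes "a \<in> so 4"
  shows "a = a $$ so4_pair 0 \<cdot>\<^sub>m so4_basis 0 + (a $$ so4_pair 1 \<cdot>\<^sub>m so4_basis 1 +
    (a $$ so4_pair 2 \<cdot>\<^sub>m so4_basis 2 + (a $$ so4_pair 3 \<cdot>\<^sub>m so4_basis 3 +
    (a $$ so4_pair 4 \<cdot>\<^sub>m so4_basis 4 + a $$ so4_pair 5 \<cdot>\<^sub>m so4_basis 5))))"
proof -
  have "a $$ (r, r) = 0" if "r < 4" for r using so_skew[OF assms that that] by simp
  then show ?thesis
    using so_carrier[OF assms] so_skew[OF assms, of 0 1] so_skew[OF assms, of 0 2]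
      so_skew[OF assms, of 0 3] so_skew[OF assms, of 1 2] so_skew[OF assms, of 1 3]
      so_skew[OF assms, of 2 3]
    by (intro eq_matI) (auto simp: so4_basis_def so4_pair_def less_4_cases)
qed

lemma sum_lessThan_6: "(\<Sum>k<6. f k) = f 0 + (f 1 + (f 2 + (f 3 + (f 4 + f (5::nat)))))" for f :: "nat \<Rightarrow> real"
  by (simp add: eval_nat_numeral ac_simps)

lemma sum_lessThan_4: "(\<Sum>k<4. f k) = f 0 + (f 1 + (f 2 + f (3::nat)))" for f :: "nat \<Rightarrow> real"
  by (simp add: eval_nat_numeral ac_simps)

lemma so4_matrix_apply:
  assumes "so_linear 4 \<tau>" "a \<in> so 4" "k < 6"
  shows "\<tau> a $$ so4_pair k = (\<Sum>l<6. so4_matrix \<tau> $$ (k, l) * a $$ so4_pair l)"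
proof -
  have *: "\<tau> (so4_basis l) \<in> so 4" if "l < 6" for l
    using assms so4_basis_so[OF that] by (auto simp: so_linear_def)
  then have c: "dim_row (\<tau> (so4_basis l)) = 4" "dim_col (\<tau> (so4_basis l)) = 4" if "l < 6" for l
    using so_carrier that by blast+
  obtain r s where rs: "so4_pair k = (r, s)" "r < 4" "s < 4"
    using so4_pair_less[OF assms(3)] by (cases "so4_pair k") auto
  have "\<tau> a = a $$ so4_pair 0 \<cdot>\<^sub>m \<tau> (so4_basis 0) + (a $$ so4_pair 1 \<cdot>\<^sub>m \<tau> (so4_basis 1) +
    (a $$ so4_pair 2 \<cdot>\<^sub>m \<tau> (so4_basis 2) + (a $$ so4_pair 3 \<cdot>\<^sub>m \<tau> (so4_basis 3) +
    (a $$ so4_pair 4 \<cdot>\<^sub>m \<tau> (so4_basis 4) + a $$ so4_pair 5 \<cdot>\<^sub>m \<tau> (so4_basis 5)))))"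
    using assms(1) so4_basis_so
    by (subst so4_expand[OF assms(2)]) (simp add: so_linear_def so_add so_smult)
  then show ?thesis
    using rs assms(3) by (simp add: sum_lessThan_6 so4_matrix_def c mult.commute)
qed

lemma so4_matrix_carrier [simp]: "so4_matrix \<tau> \<in> carrier_mat 6 6"
  by (simp add: so4_matrix_def)

lemma so4_matrix_comp:
  assumes "so_linear 4 \<tau>" "so_linear 4 \<sigma>"
  shows "so4_matrix (\<lambda>a. \<tau> (\<sigma> a)) = so4_matrix \<tau> * so4_matrix \<sigma>"
proof (rule eq_matI)
  fix k l assume "k < dim_row (so4_matrix \<tau> * so4_matrix \<sigma>)" "l < dim_col (so4_matrix \<tau> * so4_matrix \<sigma>)"
  then have kl: "k < 6" "l < 6" by (simp_all add: so4_matrix_def)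
  have "\<sigma> (so4_basis l) \<in> so 4" using assms(2) so4_basis_so[OF kl(2)] by (auto simp: so_linear_def)
  from so4_matrix_apply[OF assms(1) this kl(1)]
  have "\<tau> (\<sigma> (so4_basis l)) $$ so4_pair k
    = (\<Sum>m<6. so4_matrix \<tau> $$ (k, m) * \<sigma> (so4_basis l) $$ so4_pair m)" .
  then show "so4_matrix (\<lambda>a. \<tau> (\<sigma> a)) $$ (k, l) = (so4_matrix \<tau> * so4_matrix \<sigma>) $$ (k, l)"
    using kl by (simp add: so4_matrix_def scalar_prod_def atLeast0LessThan)
qed (simp_all add: so4_matrix_def)

definition so4_det :: "(real mat \<Rightarrow> real mat) \<Rightarrow> real" where
  "so4_det \<tau> = det (so4_matrix \<tau>)"

lemma so4_det_comp:
  "so_linear 4 \<tau> \<Longrightarrow> so_linear 4 \<sigma> \<Longrightarrow> so4_det (\<lambda>a. \<tau> (\<sigma> a)) = so4_det \<tau> * so4_det \<sigma>"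
  by (simp add: so4_det_def so4_matrix_comp det_mult[of _ 6])

text \<open>All basis matrices lie in \<open>so 4\<close>, so values elsewhere do not count.
  Identities between bundle maps are known only there.\<close>

lemma so4_det_cong: "(\<And>a. a \<in> so 4 \<Longrightarrow> \<tau> a = \<sigma> a) \<Longrightarrow> so4_det \<tau> = so4_det \<sigma>"
  unfolding so4_det_def so4_matrix_def
  by (rule arg_cong[where f = det], rule eq_matI) (auto simp: so4_basis_so)

lemma so4_basis_pair: "k < 6 \<Longrightarrow> l < 6 \<Longrightarrow> so4_basis l $$ so4_pair k = (if k = l then 1 else 0)"
  by (auto simp: so4_basis_def so4_pair_def less_6_cases)

text \<open>By skewness the trace of a b counts every pair r < s twice with sign -1, which turns
  -1/(16 pi^2) into 1/(8 pi^2). The pairing being a multiple of the standard one, isometries have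
  orthogonal matrices.\<close>

lemma ipg_so4:
  assumes "a \<in> so 4" "b \<in> so 4"
  shows "ipg 4 a b = 1 / (8 * pi\<^sup>2) * (\<Sum>k<6. a $$ so4_pair k * b $$ so4_pair k)"
proof -
  have d: "a $$ (r, r) = 0" "b $$ (r, r) = 0" if "r < 4" for r
    using so_skew[OF assms(1) that that] so_skew[OF assms(2) that that] by simp_all
  have "(\<Sum>i<4. (a * b) $$ (i, i)) = (\<Sum>i<4. \<Sum>j<4. a $$ (i, j) * b $$ (j, i))"
    using so_carrier[OF assms(1)] so_carrier[OF assms(2)]
    by (auto simp: scalar_prod_def atLeast0LessThan intro!: sum.cong)
  also have "\<dots> = - 2 * (\<Sum>k<6. a $$ so4_pair k * b $$ so4_pair k)"
    using so_skew[OF assms(1), of 0 1] so_skew[OF assms(1), of 0 2] so_skew[OF assms(1), of 0 3]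
      so_skew[OF assms(1), of 1 2] so_skew[OF assms(1), of 1 3] so_skew[OF assms(1), of 2 3]
      so_skew[OF assms(2), of 0 1] so_skew[OF assms(2), of 0 2] so_skew[OF assms(2), of 0 3]
      so_skew[OF assms(2), of 1 2] so_skew[OF assms(2), of 1 3] so_skew[OF assms(2), of 2 3]
    unfolding sum_lessThan_6 sum_lessThan_4 by (simp add: d so4_pair_def)
  finally show ?thesis by (simp add: ipg_def)
qed

lemma so4_det_isometry:
  assumes "so_linear 4 \<tau>" "\<And>a b. a \<in> so 4 \<Longrightarrow> b \<in> so 4 \<Longrightarrow> ipg 4 (\<tau> a) (\<tau> b) = ipg 4 a b"
  shows "so4_det \<tau> \<noteq> 0"
proof -
  let ?T = "so4_matrix \<tau>"
  have "transpose_mat ?T * ?T = 1\<^sub>m 6"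
  proof (rule eq_matI)
    fix k l assume "k < dim_row (1\<^sub>m 6 :: real mat)" "l < dim_col (1\<^sub>m 6 :: real mat)"
    then have kl: "k < 6" "l < 6" by simp_all
    have in_so: "so4_basis m \<in> so 4" "\<tau> (so4_basis m) \<in> so 4" if "m < 6" for m
      using assms(1) so4_basis_so[OF that] by (auto simp: so_linear_def)
    have "(transpose_mat ?T * ?T) $$ (k, l)
      = (\<Sum>m<6. \<tau> (so4_basis k) $$ so4_pair m * \<tau> (so4_basis l) $$ so4_pair m)"
      using kl by (simp add: so4_matrix_def scalar_prod_def atLeast0LessThan)
    also have "\<dots> = (\<Sum>m<6. so4_basis k $$ so4_pair m * so4_basis l $$ so4_pair m)"
      using assms(2)[of "so4_basis k" "so4_basis l"] kl by (simp add: ipg_so4 in_so)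
    also have "\<dots> = (\<Sum>m<6. if m = k then if m = l then 1 else 0 else 0)"
      using kl by (intro sum.cong) (auto simp: so4_basis_pair)
    finally show "(transpose_mat ?T * ?T) $$ (k, l) = 1\<^sub>m 6 $$ (k, l)" using kl by simp
  qed (simp_all add: so4_matrix_def)
  then have "det (transpose_mat ?T) * det ?T = 1"
    by (metis det_mult det_one so4_matrix_carrier transpose_carrier_mat)
  then show ?thesis by (auto simp: so4_det_def)
qed

text \<open>With the transpose instead of an inverse this is linear on \<open>so n\<close> for every
  square matrix Q, and for Q = \<open>rho n g\<close> it is literally \<open>Ad n g\<close>.\<close>

definition conj_op :: "real mat \<Rightarrow> real mat \<Rightarrow> real mat" where
  "conj_op Q A = Q * A * transpose_mat Q"

lemma so_linear_conj:
  assumes Q: "Q \<in> carrier_mat n n"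
  shows "so_linear n (conj_op Q)"
  unfolding so_linear_def
proof (intro conjI ballI allI)
  show "conj_op Q \<in> so n \<rightarrow> so n"
  proof
    fix a assume a: "a \<in> so n"
    then have "transpose_mat (conj_op Q a) = Q * (- a) * transpose_mat Q"
      using Q so_carrier[OF a] unfolding conj_op_def
      by (simp add: so_def transpose_mult[of _ n n _ n] assoc_mult_mat[of _ n n _ n _ n])
    also have "\<dots> = - conj_op Q a"
      using Q so_carrier[OF a] by (simp add: conj_op_def)
    finally show "conj_op Q a \<in> so n"
      using Q so_carrier[OF a] by (simp add: so_def conj_op_def)
  qed
next
  fix a b assume "a \<in> so n" "b \<in> so n"
  with Q show "conj_op Q (a + b) = conj_op Q a + conj_op Q b"
    by (simp add: so_carrier conj_op_def mult_add_distrib_mat[of _ n n _ n] add_mult_distrib_mat[of _ n n _ _ n])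
next
  fix a x assume "a \<in> so n"
  with Q show "conj_op Q (x \<cdot>\<^sub>m a) = x \<cdot>\<^sub>m conj_op Q a"
    using so_carrier[of a n] by (auto simp: conj_op_def mult_smult_distrib[of _ n n _ n] mult_smult_assoc_mat[of _ n n _ n])
qed

lemma so4_det_conj_mult:
  assumes "P \<in> carrier_mat 4 4" "Q \<in> carrier_mat 4 4"
  shows "so4_det (conj_op (P * Q)) = so4_det (conj_op P) * so4_det (conj_op Q)"
proof -
  have "so4_det (conj_op (P * Q)) = so4_det (\<lambda>a. conj_op P (conj_op Q a))"
  proof (rule so4_det_cong)
    fix a assume "a \<in> so 4"
    then show "conj_op (P * Q) a = conj_op P (conj_op Q a)"
      using assms so_carrier[of a 4] unfolding conj_op_def
      by (simp add: transpose_mult[of _ 4 4 _ 4] assoc_mult_mat[of _ 4 4 _ 4 _ 4])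
  qed
  then show ?thesis using assms by (simp add: so4_det_comp so_linear_conj)
qed

lemma so4_det_conj_one: "so4_det (conj_op (1\<^sub>m 4)) = 1"
proof -
  have "so4_matrix (conj_op (1\<^sub>m 4)) = 1\<^sub>m 6"
  proof (rule eq_matI)
    fix k l assume "k < dim_row (1\<^sub>m 6 :: real mat)" "l < dim_col (1\<^sub>m 6 :: real mat)"
    moreover have "conj_op (1\<^sub>m 4) (so4_basis l) = so4_basis l"
      using so_carrier[OF so4_basis_so[of l]] calculation by (simp add: conj_op_def)
    ultimately show "so4_matrix (conj_op (1\<^sub>m 4)) $$ (k, l) = 1\<^sub>m 6 $$ (k, l)"
      by (simp add: so4_matrix_def so4_basis_pair)
  qed (simp_all add: so4_matrix_def)
  then show ?thesis by (simp add: so4_det_def)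
qed

lemma so4_det_half_turn_square:
  assumes "(\<Sum>i<4. (v i)\<^sup>2) = 1"
  shows "(so4_det (conj_op (half_turn 4 v)))\<^sup>2 = 1"
  using so4_det_conj_mult[of "half_turn 4 v" "half_turn 4 v"] half_turn_square[OF assms]
  by (simp add: power2_eq_square so4_det_conj_one)

text \<open>The conjugating half-turn contributes its determinant squared, which is 1.\<close>

lemma so4_det_half_turn_eq:
  assumes "(\<Sum>i<4. (u i)\<^sup>2) = 1" "(\<Sum>i<4. (v i)\<^sup>2) = 1"
  shows "so4_det (conj_op (half_turn 4 v)) = so4_det (conj_op (half_turn 4 u))"
  using assms
proof (cases rule: half_turn_conjugate)
  case (1 w)
  then have "so4_det (conj_op (half_turn 4 v))
    = (so4_det (conj_op (half_turn 4 w)))\<^sup>2 * so4_det (conj_op (half_turn 4 u))"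
    by (simp add: so4_det_conj_mult power2_eq_square mult_carrier_mat[of _ 4 4 _ 4])
  then show ?thesis using so4_det_half_turn_square[OF 1(1)] by simp
qed simp

text \<open>Factors are removed in adjacent pairs: their determinants agree and have square 1,
  whatever the determinant of a single half-turn is.\<close>

lemma so4_det_half_turns:
  assumes "\<forall>v\<in>set vs. (\<Sum>i<4. (v i)\<^sup>2) = 1" "even (length vs)"
  shows "so4_det (conj_op (foldr (*) (map (half_turn 4) vs) (1\<^sub>m 4))) = 1"
  using assms
proof (induction vs rule: induct_list012)
  case (3 u v vs)
  then have "so4_det (conj_op (half_turn 4 u)) * so4_det (conj_op (half_turn 4 v)) = 1"
    using so4_det_half_turn_eq[of u v] so4_det_half_turn_square[of u] by (simp add: power2_eq_square)
  then show ?case using 3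
    by (simp add: so4_det_conj_mult mult_carrier_mat[of _ 4 4 _ 4])
qed (simp_all add: so4_det_conj_one)

text \<open>Conjugation by diag(e, 1, ..., 1): the identity for e = 1, and for e = -1 the
  automorphism induced by the reflection in the first axis. One formula thus covers both values of a
  sign cocycle.\<close>

definition axis_flip :: "nat \<Rightarrow> real \<Rightarrow> real mat \<Rightarrow> real mat" where
  "axis_flip n e a = mat n n (\<lambda>(r, s).
     (if r = 0 then e else 1) * (if s = 0 then e else 1) * a $$ (r, s))"

text \<open>Three of the six coordinate planes contain axis 0, and each of them is scaled by
  \<open>e\<close>.\<close>

lemma so4_det_axis_flip: "so4_det (axis_flip 4 e) = e ^ 3"
proof -
  have 1: "so4_matrix (axis_flip 4 e) = mat 6 6 (\<lambda>(k, l). if k = l then if k < 3 then e else 1 else 0)"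
  proof (rule eq_matI)
    fix k l assume "k < dim_row (mat 6 6 (\<lambda>(k, l). if k = l then if k < 3 then e else 1 else 0))"
      "l < dim_col (mat 6 6 (\<lambda>(k, l). if k = l then if k < 3 then e else 1 else 0))"
    then show "so4_matrix (axis_flip 4 e) $$ (k, l)
      = mat 6 6 (\<lambda>(k, l). if k = l then if k < 3 then e else 1 else 0) $$ (k, l)"
      by (auto simp: so4_matrix_def axis_flip_def so4_basis_def so4_pair_def less_6_cases)
  qed (simp_all add: so4_matrix_def)
  have "det (mat 6 6 (\<lambda>(k, l). if k = l then if k < 3 then e else 1 else 0))
    = prod_list (diag_mat (mat 6 6 (\<lambda>(k, l). if k = l then if k < 3 then e else 1 else 0)))"
    by (rule det_upper_triangular[of _ 6]) auto
  also have "\<dots> = e ^ 3"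
    by (simp add: diag_mat_def upt_rec numeral_eq_Suc)
  finally show ?thesis by (simp add: so4_det_def 1)
qed

section \<open>The covering of SO(n) by Spin(n)\<close>

lemma power_minus_one_card_sym_diff:
  assumes "finite A" "finite B"
  shows "(- 1 :: real) ^ card ((A - B) \<union> (B - A)) = (- 1) ^ card A * (- 1) ^ card B"
proof -
  have "card ((A - B) \<union> (B - A)) = card (A - B) + card (B - A)"
    using assms by (intro card_Un_disjoint) auto
  moreover have "card A = card (A - B) + card (A \<inter> B)" "card B = card (B - A) + card (A \<inter> B)"
    using assms by (auto simp: card_Diff_subset_Int Int_commute card_mono)
  ultimately have "card A + card B = card ((A - B) \<union> (B - A)) + 2 * card (A \<inter> B)"
    by simp
  then have "(- 1 :: real) ^ (card A + card B)
    = (- 1) ^ (card ((A - B) \<union> (B - A)) + 2 * card (A \<inter> B))"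
    by (rule arg_cong)
  then show ?thesis
    by (simp add: power_add power_mult)
qed

lemma finite_bits: "finite {i. bit (a :: nat) i}"
proof (rule finite_subset)
  show "{i. bit a i} \<subseteq> {..<a}"
  proof
    fix i assume "i \<in> {i. bit a i}"
    then have "2 ^ i \<le> a"
      by (metis bit_take_bit_iff less_irrefl_nat mem_Collect_eq not_le take_bit_nat_eq_self)
    then show "i \<in> {..<a}" using less_le_trans[OF less_exp[of i]] by simp
  qed
qed simp

abbreviation "nxor \<equiv> (semiring_bit_operations_class.xor :: nat \<Rightarrow> nat \<Rightarrow> nat)"

lemma finite_cl_sign_set: "finite {(i, j). bit (a::nat) i \<and> bit (b::nat) j \<and> j < i}"
  by (rule finite_subset[OF _ finite_cartesian_product[OF finite_bits[of a] finite_bits[of b]]]) auto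

text \<open>The digits of an xor are the symmetric difference of those of its arguments, and the
  inversion sets counted by \<open>cl_sign\<close> behave in the same way. The sign is therefore
  bimultiplicative, and the sign rules for associativity and reversal follow from this.\<close>

lemma cl_sign_xor_left: "cl_sign (nxor a b) c = cl_sign a c * cl_sign b c"
  unfolding cl_sign_def
  by (subst power_minus_one_card_sym_diff[symmetric, OF finite_cl_sign_set finite_cl_sign_set],
      rule arg_cong[where f = "\<lambda>S. (- 1) ^ card S"]) (auto simp: bit_xor_iff)

lemma cl_sign_xor_right: "cl_sign a (nxor b c) = cl_sign a b * cl_sign a c"
  unfolding cl_sign_def
  by (subst power_minus_one_card_sym_diff[symmetric, OF finite_cl_sign_set finite_cl_sign_set],
      rule arg_cong[where f = "\<lambda>S. (- 1) ^ card S"]) (auto simp: bit_xor_iff)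

lemma cl_sign_square [simp]: "cl_sign a b * cl_sign a b = 1"
  by (simp add: cl_sign_def flip: power_add mult_2)

lemma cl_sign_0 [simp]: "cl_sign 0 a = 1" "cl_sign a 0 = 1"
  by (auto simp: cl_sign_def)

lemma cl_sign_pow2: "cl_sign (2 ^ i) (2 ^ j) = (if j < i then - 1 else 1)"
proof -
  have "{(k, l). bit (2 ^ i :: nat) k \<and> bit (2 ^ j :: nat) l \<and> l < k} = (if j < i then {(i, j)} else {})"
    by (auto simp: bit_exp_iff)
  then show ?thesis by (simp add: cl_sign_def)
qed

text \<open>Identifies the exponent k(k-1)/2 of \<open>cl_rev\<close> as a number of inversions. A
  new maximum b adds exactly the pairs (b, j) with j in A.\<close>

lemma card_strict_pairs:
  assumes "finite (S :: nat set)"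
  shows "card {(i, j). i \<in> S \<and> j \<in> S \<and> j < i} = card S * (card S - 1) div 2"
  using assms
proof (induction rule: finite_linorder_max_induct)
  case empty
  then show ?case by simp
next
  case (insert b A)
  have fin: "finite {(i, j). i \<in> A \<and> j \<in> A \<and> j < i}"
    by (rule finite_subset[OF _ finite_cartesian_product[OF insert(1) insert(1)]]) auto
  have "{(i, j). i \<in> insert b A \<and> j \<in> insert b A \<and> j < i}
    = {(i, j). i \<in> A \<and> j \<in> A \<and> j < i} \<union> {b} \<times> A"
    using insert(2) by force
  also have "card \<dots> = card {(i, j). i \<in> A \<and> j \<in> A \<and> j < i} + card A"
    using insert(2) by (subst card_Un_disjoint) (use fin insert(1) in \<open>auto simp: card_cartesian_product\<close>)
  finally have c: "card {(i, j). i \<in> insert b A \<and> j \<in> insert b A \<and> j < i}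
    = card A * (card A - 1) div 2 + card A" using insert by simp
  have "b \<notin> A" using insert by blast
  then have "card (insert b A) = Suc (card A)" using insert by simp
  moreover have "m * (m - 1) div 2 + m = Suc m * m div 2" for m :: nat
  proof -
    have "Suc m * m = m * (m - 1) + 2 * m" by (cases m) auto
    then show ?thesis by simp
  qed
  ultimately show ?case using c by simp
qed

text \<open>The sign of the reversal of a basis element is also the sign in the square of that element.\<close>

lemma cl_rev_sign: "cl_rev x a = cl_sign a a * x a"
  using card_strict_pairs[OF finite_bits[of a]] by (simp add: cl_rev_def cl_sign_def)

section \<open>The Clifford algebra as a twisted group algebra of (Z/2)^n\<close>

lemma xor_less_pow2: "a < 2 ^ n \<Longrightarrow> b < 2 ^ n \<Longrightarrow> nxor a b < 2 ^ n"
  by (metis take_bit_nat_eq_self_iff take_bit_xor)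

lemma xor_eq_iff: "nxor a b = c \<longleftrightarrow> b = nxor a c"
  by (auto simp flip: xor.assoc)

lemma xor_cancel [simp]: "nxor a (nxor a b) = b"
  by (simp flip: xor.assoc)

lemma bij_betw_xor: "a < 2 ^ n \<Longrightarrow> bij_betw (nxor a) {..<2 ^ n} {..<2 ^ n}"
  by (rule bij_betw_byWitness[where f' = "nxor a"]) (auto intro: xor_less_pow2)

text \<open>The first index determines the second as its xor with c, so the product is a convolution
  over (Z/2)^n twisted by \<open>cl_sign\<close>.\<close>

lemma cl_mul_conv:
  "cl_mul n x y c = (if c < 2 ^ n
    then \<Sum>a<2 ^ n. cl_sign a (nxor a c) * x a * y (nxor a c) else 0)"
proof (cases "c < 2 ^ n")
  case True
  have "(\<Sum>b<2 ^ n. if nxor a b = c then cl_sign a b * x a * y b else 0)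
    = cl_sign a (nxor a c) * x a * y (nxor a c)" if "a < 2 ^ n" for a
    using that True xor_less_pow2[of a n c] by (simp add: xor_eq_iff)
  then show ?thesis using True by (simp add: cl_mul_def)
qed (simp add: cl_mul_def)

lemma cl_mul_assoc: "cl_mul n (cl_mul n x y) z = cl_mul n x (cl_mul n y z)"
proof
  fix c
  show "cl_mul n (cl_mul n x y) z c = cl_mul n x (cl_mul n y z) c"
  proof (cases "c < 2 ^ n")
    case True
    have "cl_mul n (cl_mul n x y) z c = (\<Sum>d<2 ^ n. \<Sum>a<2 ^ n.
        cl_sign d (nxor d c) * cl_sign a (nxor a d) * x a * y (nxor a d) * z (nxor d c))"
      using True by (simp add: cl_mul_conv sum_distrib_left sum_distrib_right mult_ac)
    also have "\<dots> = (\<Sum>a<2 ^ n. \<Sum>d<2 ^ n.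
        cl_sign d (nxor d c) * cl_sign a (nxor a d) * x a * y (nxor a d) * z (nxor d c))"
      by (rule sum.swap)
    also have "\<dots> = (\<Sum>a<2 ^ n. \<Sum>b<2 ^ n. cl_sign a (nxor a c) * cl_sign b (nxor b (nxor a c))
        * x a * y b * z (nxor b (nxor a c)))"
    proof (rule sum.cong[OF refl])
      fix a :: nat assume a: "a \<in> {..<2 ^ n}"
      \<comment> \<open>The cocycle identity of the sign: after expansion by bimultiplicativity the
        right side contains \<open>cl_sign a c\<close> twice.\<close>
      have *: "cl_sign d (nxor d c) * cl_sign a (nxor a d)
        = cl_sign a (nxor a c) * cl_sign (nxor a d) (nxor d c)" for d
        by (simp add: cl_sign_xor_left cl_sign_xor_right mult_ac)
      have **: "nxor (nxor a d) (nxor a c) = nxor d c" for d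
        by (metis xor.assoc xor.commute xor_cancel)
      show "(\<Sum>d<2 ^ n. cl_sign d (nxor d c) * cl_sign a (nxor a d) * x a * y (nxor a d) * z (nxor d c))
        = (\<Sum>b<2 ^ n. cl_sign a (nxor a c) * cl_sign b (nxor b (nxor a c))
        * x a * y b * z (nxor b (nxor a c)))"
        using a by (subst sum.reindex_bij_betw[OF bij_betw_xor[of a n], symmetric])
          (simp_all add: * **)
    qed
    also have "\<dots> = cl_mul n x (cl_mul n y z) c"
      using True by (simp add: cl_mul_conv sum_distrib_left mult_ac xor_less_pow2)
    finally show ?thesis .
  qed (simp add: cl_mul_conv)
qed

text \<open>The substitution a |-> c xor a interchanges the two factors, and the signs collected on
  the way combine to the reversal sign \<open>cl_sign c c\<close>.\<close>

lemma cl_rev_mul: "cl_rev (cl_mul n x y) = cl_mul n (cl_rev y) (cl_rev x)"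
proof
  fix c
  show "cl_rev (cl_mul n x y) c = cl_mul n (cl_rev y) (cl_rev x) c"
  proof (cases "c < 2 ^ n")
    case True
    have "cl_mul n (cl_rev y) (cl_rev x) c
      = (\<Sum>a<2 ^ n. cl_sign a (nxor a c) * cl_rev y a * cl_rev x (nxor a c))"
      using True by (simp add: cl_mul_conv)
    also have "\<dots> = (\<Sum>a<2 ^ n. cl_sign (nxor c a) (nxor (nxor c a) c) * cl_rev y (nxor c a)
        * cl_rev x (nxor (nxor c a) c))"
      by (rule sum.reindex_bij_betw[OF bij_betw_xor[OF True], symmetric])
    also have "\<dots> = (\<Sum>a<2 ^ n. cl_sign c c * (cl_sign a (nxor a c) * x a * y (nxor a c)))"
    proof (rule sum.cong[OF refl])
      fix a
      have 1: "nxor c a = nxor a c" "nxor (nxor a c) c = a"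
        by (simp_all only: xor.commute[of c a] xor.assoc xor_self_eq xor.right_neutral)
      show "cl_sign (nxor c a) (nxor (nxor c a) c) * cl_rev y (nxor c a) * cl_rev x (nxor (nxor c a) c)
        = cl_sign c c * (cl_sign a (nxor a c) * x a * y (nxor a c))"
        unfolding 1 cl_rev_sign
        by (simp add: cl_sign_xor_left cl_sign_xor_right mult_ac)
    qed
    also have "\<dots> = cl_rev (cl_mul n x y) c"
      using True by (simp add: cl_rev_sign cl_mul_conv sum_distrib_left)
    finally show ?thesis by simp
  qed (simp add: cl_mul_conv cl_rev_sign)
qed

lemma cl_mul_diff_left: "cl_mul n (\<lambda>c. x c - y c) z = (\<lambda>c. cl_mul n x z c - cl_mul n y z c)"
  by (rule ext) (simp add: cl_mul_conv algebra_simps sum_subtractf)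

lemma cl_mul_scale_left: "cl_mul n (\<lambda>c. k * x c) z = (\<lambda>c. k * cl_mul n x z c)"
  by (rule ext) (simp add: cl_mul_conv sum_distrib_left mult_ac)

text \<open>\<open>cl_mul\<close> cuts off at 2 ^ n, so \<open>cl_one\<close> is a unit only for
  functions that vanish from there on.\<close>

lemma cl_mul_one_left: "(\<And>c. \<not> c < 2 ^ n \<Longrightarrow> y c = 0) \<Longrightarrow> cl_mul n cl_one y = y"
  by (rule ext) (simp add: cl_mul_conv cl_one_def if_distrib[where f = "\<lambda>x. _ * x * _"] cong: if_cong)

lemma cl_mul_one_right:
  assumes "\<And>c. \<not> c < 2 ^ n \<Longrightarrow> y c = 0"
  shows "cl_mul n y cl_one = y"
proof
  fix c
  have "nxor a c = 0 \<longleftrightarrow> a = c" for a by (metis xor_eq_iff xor_self_eq xor.right_neutral)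
  then show "cl_mul n y cl_one c = y c"
    using assms[of c]
    by (auto simp: cl_mul_conv cl_one_def if_distrib[where f = "\<lambda>x. _ * x"] cong: if_cong)
qed

section \<open>Vectors and the Clifford relations\<close>

lemma cl_vec_eq_0: "\<not> c < 2 ^ n \<Longrightarrow> cl_vec n v c = 0"
  by (auto simp: cl_vec_def intro!: sum.neutral)

lemma cl_vec_pow2: "i < n \<Longrightarrow> cl_vec n v (2 ^ i) = v i"
  by (simp add: cl_vec_def)

lemma cl_rev_one: "cl_rev cl_one = cl_one"
  by (rule ext) (simp add: cl_rev_sign cl_one_def)

lemma cl_rev_vec: "cl_rev (cl_vec n v) = cl_vec n v"
  by (rule ext) (auto simp: cl_rev_sign cl_vec_def sum_distrib_left cl_sign_pow2 intro!: sum.cong)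

lemma cl_mul_vec_vec:
  assumes "c < 2 ^ n"
  shows "cl_mul n (cl_vec n v) (cl_vec n w) c
    = (\<Sum>i<n. \<Sum>j<n. if nxor (2 ^ i) (2 ^ j) = c then cl_sign (2 ^ i) (2 ^ j) * v i * w j else 0)"
proof -
  \<comment> \<open>The conditions are nested such that, after exchanging sums, the sum over b and
    then the sum over a collapse to single terms.\<close>
  have *: "(if nxor a b = c then cl_sign a b * (\<Sum>i<n. if a = 2 ^ i then v i else 0)
      * (\<Sum>j<n. if b = 2 ^ j then w j else 0) else 0)
    = (\<Sum>i<n. \<Sum>j<n. if b = 2 ^ j then (if a = 2 ^ i then (if nxor (2 ^ i) (2 ^ j) = c
        then cl_sign (2 ^ i) (2 ^ j) * v i * w j else 0) else 0) else 0)" for a b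
  proof (cases "nxor a b = c")
    case True
    then show ?thesis
      by (simp only: True simp_thms if_True mult.assoc sum_product, simp only: sum_distrib_left,
          intro sum.cong refl) auto
  next
    case False
    then show ?thesis
      by (auto intro!: sum.neutral[symmetric] sum.neutral)
  qed
  have "cl_mul n (cl_vec n v) (cl_vec n w) c = (\<Sum>a<(2::nat) ^ n. \<Sum>b<(2::nat) ^ n. \<Sum>i<n. \<Sum>j<n.
      if b = 2 ^ j then (if a = 2 ^ i then (if nxor (2 ^ i) (2 ^ j) = c
        then cl_sign (2 ^ i) (2 ^ j) * v i * w j else 0) else 0) else 0)"
    using assms unfolding cl_mul_def cl_vec_def by (simp only: * if_True)
  also have "\<dots> = (\<Sum>a<(2::nat) ^ n. \<Sum>i<n. \<Sum>b<(2::nat) ^ n. \<Sum>j<n.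
      if b = 2 ^ j then (if a = 2 ^ i then (if nxor (2 ^ i) (2 ^ j) = c
        then cl_sign (2 ^ i) (2 ^ j) * v i * w j else 0) else 0) else 0)"
    by (rule sum.cong[OF refl], rule sum.swap)
  also have "\<dots> = (\<Sum>i<n. \<Sum>a<(2::nat) ^ n. \<Sum>b<(2::nat) ^ n. \<Sum>j<n.
      if b = 2 ^ j then (if a = 2 ^ i then (if nxor (2 ^ i) (2 ^ j) = c
        then cl_sign (2 ^ i) (2 ^ j) * v i * w j else 0) else 0) else 0)"
    by (rule sum.swap)
  also have "\<dots> = (\<Sum>i<n. \<Sum>a<(2::nat) ^ n. \<Sum>j<n. \<Sum>b<(2::nat) ^ n.
      if b = 2 ^ j then (if a = 2 ^ i then (if nxor (2 ^ i) (2 ^ j) = c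
        then cl_sign (2 ^ i) (2 ^ j) * v i * w j else 0) else 0) else 0)"
    by (rule sum.cong[OF refl], rule sum.cong[OF refl], rule sum.swap)
  also have "\<dots> = (\<Sum>i<n. \<Sum>a<(2::nat) ^ n. \<Sum>j<n.
      if a = 2 ^ i then (if nxor (2 ^ i) (2 ^ j) = c
        then cl_sign (2 ^ i) (2 ^ j) * v i * w j else 0) else 0)"
    by (intro sum.cong refl) simp
  also have "\<dots> = (\<Sum>i<n. \<Sum>j<n. \<Sum>a<(2::nat) ^ n.
      if a = 2 ^ i then (if nxor (2 ^ i) (2 ^ j) = c
        then cl_sign (2 ^ i) (2 ^ j) * v i * w j else 0) else 0)"
    by (rule sum.cong[OF refl], rule sum.swap)
  also have "\<dots> = (\<Sum>i<n. \<Sum>j<n. if nxor (2 ^ i) (2 ^ j) = c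
        then cl_sign (2 ^ i) (2 ^ j) * v i * w j else 0)"
    by (intro sum.cong refl) simp
  finally show ?thesis .
qed

text \<open>For i different from j the two contributions cancel, since exchanging two different
  powers of 2 changes the sign \<open>cl_sign\<close>; the diagonal terms have index 0, which is the
  index of \<open>cl_one\<close>.\<close>

lemma cl_mul_vec_anticommute:
  "cl_mul n (cl_vec n v) (cl_vec n w) c + cl_mul n (cl_vec n w) (cl_vec n v) c
    = 2 * (\<Sum>i<n. v i * w i) * cl_one c"
proof (cases "c < 2 ^ n")
  case True
  have "cl_mul n (cl_vec n w) (cl_vec n v) c
    = (\<Sum>i<n. \<Sum>j<n. if nxor (2 ^ j) (2 ^ i) = c then cl_sign (2 ^ j) (2 ^ i) * w j * v i else 0)"
    unfolding cl_mul_vec_vec[OF True] by (rule sum.swap)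
  moreover have "(if nxor (2 ^ i) (2 ^ j) = c then cl_sign (2 ^ i) (2 ^ j) * v i * w j else 0)
      + (if nxor (2 ^ j) (2 ^ i) = c then cl_sign (2 ^ j) (2 ^ i) * w j * v i else 0)
    = (if j = i then 2 * (v i * w i) * cl_one c else 0)" for i j
    by (cases i j rule: linorder_cases) (auto simp: cl_sign_pow2 cl_one_def xor.commute[of "2 ^ j"])
  ultimately have "cl_mul n (cl_vec n v) (cl_vec n w) c + cl_mul n (cl_vec n w) (cl_vec n v) c
    = (\<Sum>i<n. \<Sum>j<n. if j = i then 2 * (v i * w i) * cl_one c else 0)"
    unfolding cl_mul_vec_vec[OF True, of v w] by (simp only: sum.distrib[symmetric])
  also have "\<dots> = 2 * (\<Sum>i<n. v i * w i) * cl_one c"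
    by (simp add: sum_distrib_left sum_distrib_right mult_ac)
  finally show ?thesis .
qed (auto simp: cl_mul_conv cl_one_def)

text \<open>Compute v w v = (2 (v.w) - w v) v = 2 (v.w) v - w, using the Clifford relation and v v =
  1.\<close>

lemma cl_vec_conjugation:
  assumes "(\<Sum>i<n. (v i)\<^sup>2) = 1"
  shows "cl_mul n (cl_mul n (cl_vec n v) (cl_vec n w)) (cl_vec n v)
    = cl_vec n (\<lambda>i. 2 * (\<Sum>j<n. v j * w j) * v i - w i)"
proof -
  let ?v = "cl_vec n v" and ?w = "cl_vec n w"
  have vv: "cl_mul n ?v ?v = cl_one"
    using cl_mul_vec_anticommute[of n v v] assms by (auto simp: power2_eq_square)
  have "cl_mul n ?v ?w = (\<lambda>c. 2 * (\<Sum>j<n. v j * w j) * cl_one c - cl_mul n ?w ?v c)"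
    using cl_mul_vec_anticommute[of n v w] by (auto simp: algebra_simps)
  then have "cl_mul n (cl_mul n ?v ?w) ?v = (\<lambda>c. 2 * (\<Sum>j<n. v j * w j) * ?v c - ?w c)"
    by (simp add: cl_mul_diff_left cl_mul_scale_left cl_mul_one_left cl_vec_eq_0 cl_mul_assoc vv
        cl_mul_one_right)
  also have "\<dots> = cl_vec n (\<lambda>i. 2 * (\<Sum>j<n. v j * w j) * v i - w i)"
    by (rule ext) (auto simp: cl_vec_def sum_distrib_left simp flip: sum_subtractf intro!: sum.cong)
  finally show ?thesis .
qed

text \<open>Reversal turns conjugation by v h into conjugation by h followed by conjugation by v;
  the vector reached after h is column j of the partial product.\<close>

lemma cl_conjugation_half_turns:
  assumes "\<forall>v\<in>set vs. (\<Sum>i<n. (v i)\<^sup>2) = 1" "j < n"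
  defines "g \<equiv> foldr (cl_mul n) (map (cl_vec n) vs) cl_one"
  defines "Q \<equiv> foldr (*) (map (half_turn n) vs) (1\<^sub>m n)"
  shows "cl_mul n (cl_mul n g (cl_vec n (\<lambda>k. if k = j then 1 else 0))) (cl_rev g)
    = cl_vec n (\<lambda>i. Q $$ (i, j))"
  using assms(1) unfolding g_def Q_def
proof (induction vs)
  case Nil
  show ?case using assms(2)
    by (simp add: cl_rev_one cl_mul_one_left cl_mul_one_right cl_vec_eq_0)
      (rule ext, auto simp: cl_vec_def intro!: sum.cong)
next
  case (Cons v vs)
  let ?h = "foldr (cl_mul n) (map (cl_vec n) vs) cl_one"
  let ?Q = "foldr (*) (map (half_turn n) vs) (1\<^sub>m n)"
  let ?e = "cl_vec n (\<lambda>k. if k = j then 1 else 0)"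
  have "cl_mul n (cl_mul n (cl_mul n (cl_vec n v) ?h) ?e) (cl_rev (cl_mul n (cl_vec n v) ?h))
    = cl_mul n (cl_mul n (cl_vec n v) (cl_mul n (cl_mul n ?h ?e) (cl_rev ?h))) (cl_vec n v)"
    by (simp add: cl_mul_assoc cl_rev_mul cl_rev_vec)
  also have "\<dots> = cl_vec n (\<lambda>i. 2 * (\<Sum>k<n. v k * ?Q $$ (k, j)) * v i - ?Q $$ (i, j))"
    using Cons by (simp add: cl_vec_conjugation)
  also have "\<dots> = cl_vec n (\<lambda>i. (half_turn n v * ?Q) $$ (i, j))"
    using assms(2) by (auto simp: cl_vec_def half_turn_mult_index intro!: ext sum.cong simp del: index_mult_mat)
  finally show ?case by simp
qed

lemma rho_half_turns:
  assumes "\<forall>v\<in>set vs. (\<Sum>i<n. (v i)\<^sup>2) = 1"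
  shows "rho n (foldr (cl_mul n) (map (cl_vec n) vs) cl_one) = foldr (*) (map (half_turn n) vs) (1\<^sub>m n)"
proof (rule eq_matI)
  fix i j
  assume "i < dim_row (foldr (*) (map (half_turn n) vs) (1\<^sub>m n))"
    "j < dim_col (foldr (*) (map (half_turn n) vs) (1\<^sub>m n))"
  then have "i < n" "j < n" using half_turns_carrier[of n vs] by (metis carrier_matD)+
  then show "rho n (foldr (cl_mul n) (map (cl_vec n) vs) cl_one) $$ (i, j)
    = foldr (*) (map (half_turn n) vs) (1\<^sub>m n) $$ (i, j)"
    using cl_conjugation_half_turns[OF assms] by (simp add: rho_def cl_vec_pow2)
qed (simp_all add: rho_def carrier_matD[OF half_turns_carrier])

section \<open>Smoothness on open subsets of Euclidean space\<close>

lemma openin_Euclidean_space_iff: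
  "openin (Euclidean_space d) V \<longleftrightarrow> (\<exists>T. open T \<and> V = T \<inter> {x. \<forall>i\<ge>d. x i = 0})"
  by (simp add: Euclidean_space_def openin_subtopology euclidean_product_topology)

text \<open>Partial derivatives are taken along the lines x(i := t) in the space of all functions; i
  < d keeps such a line inside R^d, and openness keeps it in V for a while.\<close>

lemma eventually_upd_in_openin:
  assumes "openin (Euclidean_space d) V" "x \<in> V" "i < d"
  shows "eventually (\<lambda>t. x(i := t) \<in> V) (nhds (x i))"
proof -
  obtain T where T: "open T" "V = T \<inter> {x. \<forall>i\<ge>d. x i = 0}"
    using assms(1) by (auto simp: openin_Euclidean_space_iff)
  have "continuous_on UNIV (\<lambda>t. x(i := t))"
  proof (rule continuous_on_coordinatewise_then_product)
    show "continuous_on UNIV (\<lambda>t. (x(i := t)) j)" for j by (cases "j = i") auto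
  qed
  then have "open ((\<lambda>t. x(i := t)) -` T)"
    using T(1) by (simp add: continuous_on_open_vimage)
  moreover have "x i \<in> (\<lambda>t. x(i := t)) -` T" using assms(2) T by simp
  ultimately have "eventually (\<lambda>t. t \<in> (\<lambda>t. x(i := t)) -` T) (nhds (x i))"
    by (rule eventually_nhds_in_open)
  then show ?thesis
    by eventually_elim (use assms T(2) in auto)
qed

lemma pd_cong:
  assumes "openin (Euclidean_space d) V" "\<And>x. x \<in> V \<Longrightarrow> f x = g x" "x \<in> V" "i < d"
  shows "pd i f x = pd i g x"
  unfolding pd_def
  by (rule deriv_cong_ev[OF _ refl], rule eventually_mono[OF eventually_upd_in_openin[OF assms(1,3,4)]])
    (rule assms(2))

lemma foldr_pd_cong:
  assumes "openin (Euclidean_space d) V" "\<And>x. x \<in> V \<Longrightarrow> f x = g x" "set is \<subseteq> {..<d}" "x \<in> V"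
  shows "foldr pd is f x = foldr pd is g x"
  using assms(3,4)
proof (induction "is" arbitrary: x)
  case (Cons i "is")
  then show ?case using pd_cong[OF assms(1), of "foldr pd is f" "foldr pd is g"] by simp
qed (use assms(2) in simp)

text \<open>On an open set, values on V determine all iterated partial derivatives there. Serves to
  remove \<open>chart_inv\<close> in the only chart.\<close>

lemma smooth_on_cong:
  assumes V: "openin (Euclidean_space d) V" and eq: "\<And>x. x \<in> V \<Longrightarrow> f x = g x" and "smooth_on d V f"
  shows "smooth_on d V g"
  unfolding smooth_on_def
proof (intro allI impI conjI ballI)
  fix "is" assume js: "set is \<subseteq> {..<d}"
  have fg: "foldr pd is f x = foldr pd is g x" if "x \<in> V" for x
    using foldr_pd_cong[OF V _ js that, of f g] eq by blast
  have "continuous_on V (foldr pd is f)" using assms(3) js by (simp add: smooth_on_def)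
  then show "continuous_on V (foldr pd is g)" by (rule continuous_on_eq) (rule fg)
  fix x i assume x: "x \<in> V" "i < d"
  have ev: "eventually (\<lambda>t. foldr pd is f (x(i := t)) = foldr pd is g (x(i := t))) (nhds (x i))"
    using eventually_upd_in_openin[OF V x] by eventually_elim (rule fg)
  have "(\<lambda>t. foldr pd is f (x(i := t))) differentiable (at (x i))"
    using assms(3) js x by (simp add: smooth_on_def)
  then show "(\<lambda>t. foldr pd is g (x(i := t))) differentiable (at (x i))"
    unfolding real_differentiable_def by (simp only: DERIV_cong_ev[OF refl ev refl])
qed

text \<open>W may stick out of V, so the property passes to subsets of V with the same W.\<close>

definition locally_constant :: "nat \<Rightarrow> (nat \<Rightarrow> real) set \<Rightarrow> ((nat \<Rightarrow> real) \<Rightarrow> real) \<Rightarrow> bool" where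
  "locally_constant d V f \<longleftrightarrow>
     (\<forall>x\<in>V. \<exists>W. openin (Euclidean_space d) W \<and> x \<in> W \<and> (\<forall>y\<in>W. f y = f x))"

lemma locally_constant_upd:
  assumes "locally_constant d V f" "x \<in> V" "i < d"
  shows "eventually (\<lambda>t. f (x(i := t)) = f x) (nhds (x i))"
proof -
  obtain W where W: "openin (Euclidean_space d) W" "x \<in> W" "\<forall>y\<in>W. f y = f x"
    using assms unfolding locally_constant_def by blast
  show ?thesis
    using eventually_upd_in_openin[OF W(1,2) assms(3)] by eventually_elim (use W(3) in blast)
qed

lemma locally_constant_DERIV:
  assumes "locally_constant d V f" "x \<in> V" "i < d"
  shows "((\<lambda>t. f (x(i := t))) has_real_derivative 0) (at (x i))"
  using DERIV_cong_ev[OF refl locally_constant_upd[OF assms] refl] by simp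

text \<open>The empty list gives back f, and any other list gives a function that is 0 on V.\<close>

lemma locally_constant_foldr_pd:
  assumes "openin (Euclidean_space d) V" "locally_constant d V f" "set is \<subseteq> {..<d}"
  shows "locally_constant d V (foldr pd is f)"
  using assms(3)
proof (induction "is")
  case (Cons i "is")
  then have "pd i (foldr pd is f) x = 0" if "x \<in> V" for x
    using locally_constant_DERIV[of d V "foldr pd is f" x i, THEN DERIV_imp_deriv] that
    by (simp add: pd_def[of i])
  then show ?case using assms(1) by (auto simp: locally_constant_def intro!: exI[of _ V])
qed (use assms(2) in simp)

lemma locally_constant_continuous_on:
  assumes "openin (Euclidean_space d) V" "locally_constant d V f"
  shows "continuous_on V f"
  unfolding continuous_on_def
proof
  fix x assume x: "x \<in> V"
  obtain S where S: "V = S \<inter> {x. \<forall>i\<ge>d. x i = 0}"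
    using assms(1) by (auto simp: openin_Euclidean_space_iff)
  obtain T where T: "open T" "x \<in> T" "\<forall>y\<in>T \<inter> {x. \<forall>i\<ge>d. x i = 0}. f y = f x"
    using assms(2) x unfolding locally_constant_def openin_Euclidean_space_iff by blast
  have "eventually (\<lambda>y. y \<in> T \<and> y \<in> V) (at x within V)"
    using T(1,2) by (auto simp: eventually_at_topological)
  then have "eventually (\<lambda>y. f y = f x) (at x within V)"
    by eventually_elim (use T(3) S in auto)
  then show "(f \<longlongrightarrow> f x) (at x within V)" by (rule tendsto_eventually)
qed

lemma smooth_on_locally_constant:
  assumes "openin (Euclidean_space d) V" "locally_constant d V f"
  shows "smooth_on d V f"
  unfolding smooth_on_def real_differentiable_def
proof (intro allI impI conjI ballI)
  fix "is" assume "set is \<subseteq> {..<d}"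
  from locally_constant_foldr_pd[OF assms this] have *: "locally_constant d V (foldr pd is f)" .
  then show "continuous_on V (foldr pd is f)" by (rule locally_constant_continuous_on[OF assms(1)])
  show "\<exists>D. ((\<lambda>t. foldr pd is f (x(i := t))) has_real_derivative D) (at (x i))"
    if "x \<in> V" "i < d" for x i
    using locally_constant_DERIV[OF * that] by blast
qed

lemma locally_constant_const: "openin (Euclidean_space d) V \<Longrightarrow> locally_constant d V (\<lambda>_. k)"
  by (auto simp: locally_constant_def)

lemma locally_constant_comp: "locally_constant d V f \<Longrightarrow> locally_constant d V (\<lambda>x. h (f x))"
  unfolding locally_constant_def by metis

lemma smooth_on_coordinate: "smooth_on d V (\<lambda>x. x j)"
proof -
  have 1: "foldr pd is (\<lambda>x. x j) = (\<lambda>x. x j) \<or> (\<exists>k. foldr pd is (\<lambda>x. x j) = (\<lambda>x. k))" for "is"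
  proof (induction "is")
    case (Cons i "is")
    moreover have "pd i (\<lambda>x. x j) = (\<lambda>x. if i = j then 1 else 0)"
      by (rule ext) (simp add: pd_def)
    moreover have "pd i (\<lambda>x. k) = (\<lambda>x. 0)" for k by (rule ext) (simp add: pd_def)
    ultimately show ?case by force
  qed simp
  have 2: "(\<lambda>t. (x(i := t)) j) differentiable (at (x i))" for x :: "nat \<Rightarrow> real" and i
    by (cases "i = j") auto
  have 3: "continuous_on V (\<lambda>x. x j)"
    by (rule continuous_on_subset[OF continuous_on_product_coordinates]) simp
  show ?thesis
    unfolding smooth_on_def
  proof (intro allI impI)
    fix "is" assume "set is \<subseteq> {..<d}"
    from 1[of "is"] 2 3 show "continuous_on V (foldr pd is (\<lambda>x. x j)) \<and>
      (\<forall>x\<in>V. \<forall>i<d. (\<lambda>t. foldr pd is (\<lambda>x. x j) (x(i := t))) differentiable at (x i))"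
      by fastforce
  qed
qed

section \<open>Flat Courant morphisms on the punctured plane\<close>

definition pplane :: "(nat \<Rightarrow> real) set" where
  "pplane = {x \<in> topspace (Euclidean_space 2). x 0 \<noteq> 0 \<or> x 1 \<noteq> 0}"

definition pplane_mfd :: "(nat \<Rightarrow> real) mfd" where
  "pplane_mfd = \<lparr>mdim = 2, mtop = subtopology (Euclidean_space 2) pplane, matlas = {(pplane, id)}\<rparr>"

lemma open_coord_Collect:
  fixes j :: nat and b :: real
  shows "open {x. x j < b}" "open {x. x j > b}" "open {x. x j \<noteq> b}"
  by (auto intro!: open_Collect_less open_Collect_neq)

lemma openin_Euclidean_Collect:
  assumes "open T"
  shows "openin (Euclidean_space d) (topspace (Euclidean_space d) \<inter> T)"
  using assms by (auto simp: openin_Euclidean_space_iff topspace_Euclidean_space)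

lemma openin_pplane: "openin (Euclidean_space 2) pplane"
proof -
  have "pplane = topspace (Euclidean_space 2) \<inter> ({x. x 0 \<noteq> 0} \<union> {x. x 1 \<noteq> 0})"
    by (auto simp: pplane_def)
  then show ?thesis
    by (metis openin_Euclidean_Collect open_Un open_coord_Collect(3))
qed

lemma second_countable_Euclidean_space: "second_countable (Euclidean_space d)"
proof -
  obtain \<B> :: "(nat \<Rightarrow> real) set set" where
    "countable \<B>" "\<And>C. C \<in> \<B> \<Longrightarrow> open C" "\<And>S. open S \<Longrightarrow> \<exists>U. U \<subseteq> \<B> \<and> S = \<Union>U"
    using univ_second_countable by blast
  then have "second_countable (euclidean :: (nat \<Rightarrow> real) topology)"
    unfolding second_countable_def open_openin[symmetric] by (intro exI[of _ \<B>]) blast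
  then show ?thesis
    by (simp add: Euclidean_space_def euclidean_product_topology second_countable_subtopology)
qed

text \<open>Off \<open>pplane\<close> the value of \<open>inv_into\<close> is unspecified, so
  \<open>chart_inv\<close> is not the identity as a function; the congruence lemmas for
  \<open>pd\<close> and \<open>smooth_on\<close> bridge the gap.\<close>

lemma chart_inv_pplane: "x \<in> pplane \<Longrightarrow> chart_inv (pplane, id) x = x"
  by (simp add: chart_inv_def)

lemma smooth_manifold_pplane: "smooth_manifold pplane_mfd"
proof -
  have "smooth_on 2 pplane (\<lambda>x. chart_inv (pplane, id) x j)" for j
    by (rule smooth_on_cong[OF openin_pplane _ smooth_on_coordinate[where j = j]])
      (simp add: chart_inv_pplane)
  moreover have "topspace (subtopology (Euclidean_space 2) pplane) = pplane"
    by (auto simp: pplane_def)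
  moreover from this have "openin (subtopology (Euclidean_space 2) pplane) pplane"
    by (metis openin_topspace)
  ultimately show ?thesis
    using openin_pplane
    by (auto simp: smooth_manifold_def pplane_mfd_def Hausdorff_space_subtopology
        Hausdorff_Euclidean_space second_countable_subtopology second_countable_Euclidean_space
        subtopology_subtopology)
qed

lemma pplane_mfd_simps [simp]:
  "mdim pplane_mfd = 2" "matlas pplane_mfd = {(pplane, id)}"
  "mtop pplane_mfd = subtopology (Euclidean_space 2) pplane"
  by (simp_all add: pplane_mfd_def)

lemma smooth_on_chart_iff:
  assumes "openin (Euclidean_space 2) V" "V \<subseteq> pplane"
  shows "smooth_on 2 (id ` (V \<inter> pplane)) (\<lambda>x. f (chart_inv (pplane, id) x)) \<longleftrightarrow> smooth_on 2 V f"
proof -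
  have "f (chart_inv (pplane, id) x) = f x" if "x \<in> V" for x
    using that assms(2) by (auto simp: chart_inv_pplane)
  moreover have "id ` (V \<inter> pplane) = V" using assms(2) by auto
  ultimately show ?thesis
    using smooth_on_cong[OF assms(1), of "\<lambda>x. f (chart_inv (pplane, id) x)" f]
      smooth_on_cong[OF assms(1), of f "\<lambda>x. f (chart_inv (pplane, id) x)"] by metis
qed

lemma cpd_pplane:
  assumes "p \<in> pplane" "i < 2"
  shows "cpd (pplane, id) i f p = pd i f p"
  unfolding cpd_def
  using pd_cong[OF openin_pplane _ assms, of "\<lambda>x. f (chart_inv (pplane, id) x)" f]
  by (simp add: chart_inv_pplane)

lemma smooth_on_const: "openin (Euclidean_space 2) V \<Longrightarrow> smooth_on 2 V (\<lambda>_. k)"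
  by (intro smooth_on_locally_constant locally_constant_const)

section \<open>Vanishing forms\<close>

lemma tensor_field_zero:
  assumes "openin (Euclidean_space 2) V" "V \<subseteq> pplane"
  shows "tensor_field pplane_mfd k V (\<lambda>c p is. 0)"
  using smooth_on_chart_iff[OF assms, of "\<lambda>_. 0"] smooth_on_const[OF assms(1)]
  by (simp add: tensor_field_def)

lemma diff_form_zero:
  assumes "openin (Euclidean_space 2) V" "V \<subseteq> pplane"
  shows "diff_form pplane_mfd k V (\<lambda>c p is. 0)"
  using tensor_field_zero[OF assms] by (simp add: diff_form_def)

lemma so_form_zero:
  assumes "openin (Euclidean_space 2) V" "V \<subseteq> pplane"
  shows "so_form n pplane_mfd k V (\<lambda>c p is. 0\<^sub>m n n)"
  using diff_form_zero[OF assms] by (auto simp: so_form_def intro!: soI)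

lemma ipg_zero: "ipg n (0\<^sub>m n n) (0\<^sub>m n n) = 0"
  by (simp add: ipg_def)

lemma ipg_zero_right: "a \<in> carrier_mat n n \<Longrightarrow> ipg n a (0\<^sub>m n n) = 0"
  by (simp add: ipg_def)

lemma ext_d_zero:
  assumes "p \<in> pplane" "set is \<subseteq> {..<2}"
  shows "ext_d (\<lambda>c q js. 0) (pplane, id) p is = 0"
  unfolding ext_d_def
proof (rule sum.neutral, rule ballI)
  fix m assume "m \<in> {..<length is}"
  then have "is ! m < 2" using assms(2) nth_mem by fastforce
  then show "(- 1) ^ m * cpd (pplane, id) (is ! m) (\<lambda>q. 0) p = 0"
    using cpd_pplane[OF assms(1), of "is ! m" "\<lambda>q. 0"] by (simp add: pd_def)
qed

section \<open>The axis flip as an isometric automorphism of so(n)\<close>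

lemma axis_flip_carrier [simp]: "axis_flip n e a \<in> carrier_mat n n"
  by (simp add: axis_flip_def)

lemma axis_flip_index:
  "r < n \<Longrightarrow> s < n \<Longrightarrow> axis_flip n e a $$ (r, s)
    = (if r = 0 then e else 1) * (if s = 0 then e else 1) * a $$ (r, s)"
  by (simp add: axis_flip_def)

lemma axis_flip_dims [simp]: "dim_row (axis_flip n e a) = n" "dim_col (axis_flip n e a) = n"
  by (simp_all add: axis_flip_def)

lemma axis_flip_so:
  assumes "a \<in> so n"
  shows "axis_flip n e a \<in> so n"
proof (rule soI)
  fix r s assume "r < n" "s < n"
  then show "axis_flip n e a $$ (s, r) = - axis_flip n e a $$ (r, s)"
    using so_skew[OF assms, of r s] by (simp add: axis_flip_index)
qed simp

lemma axis_flip_one: "a \<in> carrier_mat n n \<Longrightarrow> axis_flip n 1 a = a"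
  by (auto simp: axis_flip_def intro!: eq_matI)

lemma axis_flip_axis_flip: "axis_flip n e (axis_flip n e' a) = axis_flip n (e * e') a"
  by (auto simp: axis_flip_def intro!: eq_matI)

text \<open>The weight of the summation index enters each term squared, hence as 1. Compatibility
  with \<open>lie\<close> and with the trace form follows from this.\<close>

lemma axis_flip_mult:
  assumes "e * e = 1" "a \<in> carrier_mat n n" "b \<in> carrier_mat n n"
  shows "axis_flip n e a * axis_flip n e b = axis_flip n e (a * b)"
proof (rule eq_matI)
  let ?w = "\<lambda>r :: nat. if r = 0 then e else 1"
  fix r s assume "r < dim_row (axis_flip n e (a * b))" "s < dim_col (axis_flip n e (a * b))"
  then have rs: "r < n" "s < n" by simp_all
  have w: "?w k * ?w k = 1" for k using assms(1) by simp
  have "(axis_flip n e a * axis_flip n e b) $$ (r, s)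
    = (\<Sum>k<n. ?w r * ?w s * (?w k * ?w k) * (a $$ (r, k) * b $$ (k, s)))"
    using rs by (simp add: scalar_prod_def atLeast0LessThan axis_flip_index mult_ac cong: if_cong)
  also have "\<dots> = axis_flip n e (a * b) $$ (r, s)"
    unfolding w using rs assms(2,3)
    by (simp add: axis_flip_index scalar_prod_def atLeast0LessThan sum_distrib_left cong: if_cong)
  finally show "(axis_flip n e a * axis_flip n e b) $$ (r, s) = axis_flip n e (a * b) $$ (r, s)" .
qed simp_all

lemma axis_flip_add:
  "a \<in> carrier_mat n n \<Longrightarrow> b \<in> carrier_mat n n \<Longrightarrow>
    axis_flip n e (a + b) = axis_flip n e a + axis_flip n e b"
  by (rule eq_matI) (simp_all add: axis_flip_index distrib_left)

lemma axis_flip_smult: "a \<in> carrier_mat n n \<Longrightarrow> axis_flip n e (x \<cdot>\<^sub>m a) = x \<cdot>\<^sub>m axis_flip n e a"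
  by (rule eq_matI) (simp_all add: axis_flip_index)

lemma axis_flip_lie:
  assumes "e * e = 1" "a \<in> carrier_mat n n" "b \<in> carrier_mat n n"
  shows "axis_flip n e (lie a b) = lie (axis_flip n e a) (axis_flip n e b)"
  unfolding lie_def axis_flip_mult[OF assms] axis_flip_mult[OF assms(1,3,2)]
  using assms(2,3) by (intro eq_matI) (simp_all add: axis_flip_index right_diff_distrib)

lemma ipg_axis_flip:
  assumes "e * e = 1" "a \<in> carrier_mat n n" "b \<in> carrier_mat n n"
  shows "ipg n (axis_flip n e a) (axis_flip n e b) = ipg n a b"
  unfolding ipg_def axis_flip_mult[OF assms]
  using assms(1) by (auto simp: axis_flip_index intro!: sum.cong)

lemma so_linear_axis_flip: "so_linear n (axis_flip n e)"
  by (auto simp: so_linear_def axis_flip_so so_carrier axis_flip_add axis_flip_smult)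

lemma lie_automorphism_axis_flip:
  assumes V: "openin (Euclidean_space 2) V" "V \<subseteq> pplane"
    and e: "locally_constant 2 V e" "\<And>p. p \<in> V \<Longrightarrow> e p * e p = 1"
  shows "lie_automorphism_field n pplane_mfd V (\<lambda>p. axis_flip n (e p))"
proof -
  have "bij_betw (axis_flip n (e p)) (so n) (so n)" if "p \<in> V" for p
    by (rule bij_betw_byWitness[where f' = "axis_flip n (e p)"])
      (use e(2)[OF that] in \<open>auto simp: axis_flip_so axis_flip_axis_flip so_carrier axis_flip_one\<close>)
  moreover have "smooth_fun pplane_mfd V (\<lambda>p. axis_flip n (e p) a $$ (r, s))" for a r s
    unfolding smooth_fun_def
    using smooth_on_chart_iff[OF V, of "\<lambda>p. axis_flip n (e p) a $$ (r, s)"]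
      smooth_on_locally_constant[OF V(1) locally_constant_comp[OF e(1), where h = "\<lambda>e. axis_flip n e a $$ (r, s)"]]
    by simp
  ultimately show ?thesis
    unfolding lie_automorphism_field_def
    using e(2) by (auto simp: so_carrier axis_flip_add axis_flip_lie ipg_axis_flip axis_flip_smult)
qed

section \<open>Courant automorphisms given by locally constant signs\<close>

abbreviation flip_triple :: "nat \<Rightarrow> ((nat \<Rightarrow> real) \<Rightarrow> real) \<Rightarrow> (nat \<Rightarrow> real) triple" where
  "flip_triple n e \<equiv> (\<lambda>c p is. 0\<^sub>m n n, \<lambda>p. axis_flip n (e p), \<lambda>c p is. 0)"

lemma apply_flip_triple:
  "apply_triple n d (flip_triple n e) c p x = (fst x, axis_flip n (e p) (fst (snd x)), snd (snd x))"
proof -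
  have "mat n n (\<lambda>(r, s). \<Sum>i<d. fst x i * 0\<^sub>m n n $$ (r, s)) + axis_flip n (e p) (fst (snd x))
    = axis_flip n (e p) (fst (snd x))"
    by (rule eq_matI) auto
  then show ?thesis
    by (simp add: apply_triple_def split_beta ipg_zero_right)
qed

lemma apply_triple_id:
  assumes "a \<in> carrier_mat n n"
  shows "apply_triple n d (triple_id n) c p (X, a, \<xi>) = (X, a, \<xi>)"
proof -
  have "mat n n (\<lambda>(r, s). \<Sum>i<d. X i * 0\<^sub>m n n $$ (r, s)) + a = a"
    using assms by (intro eq_matI) auto
  then show ?thesis
    using assms by (simp add: apply_triple_def triple_id_def ipg_zero_right)
qed

lemma section_so:
  "is_section n pplane_mfd V s \<Longrightarrow> V \<subseteq> pplane \<Longrightarrow> p \<in> V \<Longrightarrow> fst (snd (s (pplane, id) p)) \<in> so n"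
  by (auto simp: is_section_def so_form_def idx_def subset_iff)

text \<open>The rule for \<open>deriv\<close> of a constant multiple requires differentiability,
  which is smoothness read at the empty list of derivatives.\<close>

lemma section_differentiable:
  assumes "is_section n pplane_mfd V s" "openin (Euclidean_space 2) V" "V \<subseteq> pplane" "p \<in> V"
    "i < 2" "r < n" "k < n"
  shows "(\<lambda>t. fst (snd (s (pplane, id) (p(i := t)))) $$ (r, k)) field_differentiable at (p i)"
proof -
  have "idx 2 0 = {[]}" by (auto simp: idx_def)
  moreover from assms(1,6,7) have "tensor_field pplane_mfd 0 V (\<lambda>c p is. fst (snd (s c p)) $$ (r, k))"
    unfolding is_section_def so_form_def diff_form_def by blast
  ultimately have "smooth_on 2 (id ` (V \<inter> pplane))
      (\<lambda>x. fst (snd (s (pplane, id) (chart_inv (pplane, id) x))) $$ (r, k))"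
    unfolding tensor_field_def by simp
  then have "smooth_on 2 V (\<lambda>x. fst (snd (s (pplane, id) x)) $$ (r, k))"
    using smooth_on_chart_iff[OF assms(2,3), of "\<lambda>x. fst (snd (s (pplane, id) x)) $$ (r, k)"] by simp
  then have "(\<lambda>t. foldr pd [] (\<lambda>x. fst (snd (s (pplane, id) x)) $$ (r, k)) (p(i := t)))
      differentiable (at (p i))"
    using assms(4,5) unfolding smooth_on_def by (metis empty_set empty_subsetI)
  then show ?thesis
    by (simp add: real_differentiable_def field_differentiable_def)
qed

text \<open>Near p the signs are constant along a coordinate line and leave the derivative, although
  \<open>e\<close> may differ between the components of V.\<close>

lemma cpd_axis_flip:
  assumes V: "openin (Euclidean_space 2) V" "V \<subseteq> pplane" and e: "locally_constant 2 V e"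
    and s: "is_section n pplane_mfd V s" and p: "p \<in> V" "i < 2" and rk: "r < n" "k < n"
  shows "cpd (pplane, id) i (\<lambda>q. axis_flip n (e q) (fst (snd (s (pplane, id) q))) $$ (r, k)) p
    = (if r = 0 then e p else 1) * (if k = 0 then e p else 1)
      * cpd (pplane, id) i (\<lambda>q. fst (snd (s (pplane, id) q)) $$ (r, k)) p"
proof -
  let ?h = "\<lambda>q. fst (snd (s (pplane, id) q)) $$ (r, k)"
  let ?w = "\<lambda>q. (if r = 0 then e q else 1) * (if k = 0 then e q else 1)"
  have pp: "p \<in> pplane" using V p by blast
  have "eventually (\<lambda>t. ?w (p(i := t)) * ?h (p(i := t)) = ?w p * ?h (p(i := t))) (nhds (p i))"
    using locally_constant_upd[OF e p] by eventually_elim simp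
  then have "deriv (\<lambda>t. ?w (p(i := t)) * ?h (p(i := t))) (p i) = deriv (\<lambda>t. ?w p * ?h (p(i := t))) (p i)"
    by (rule deriv_cong_ev[OF _ refl])
  also have "\<dots> = ?w p * deriv (\<lambda>t. ?h (p(i := t))) (p i)"
    by (rule deriv_cmult[OF section_differentiable[OF s V p rk]])
  finally show ?thesis
    using rk by (simp add: cpd_pplane[OF pp p(2)] pd_def axis_flip_index cong: if_cong)
qed

text \<open>Vector fields and 1-forms pass unchanged, so two places matter: the so(n)-component,
  where the flip commutes with derivatives and \<open>lie\<close>, and the term 2 (b, da), where it
  is an isometry.\<close>

lemma cbracket_flip_triple:
  assumes V: "openin (Euclidean_space 2) V" "V \<subseteq> pplane"
    and e: "locally_constant 2 V e" "\<And>p. p \<in> V \<Longrightarrow> e p * e p = 1"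
    and s: "is_section n pplane_mfd V s" "is_section n pplane_mfd V s'" and p: "p \<in> V"
  shows "elt_eq 2 (apply_triple n 2 (flip_triple n e) (pplane, id) p (cbracket n 2 s s' (pplane, id) p))
    (cbracket n 2 (\<lambda>c q. apply_triple n 2 (flip_triple n e) c q (s c q))
       (\<lambda>c q. apply_triple n 2 (flip_triple n e) c q (s' c q)) (pplane, id) p)"
proof -
  let ?c = "(pplane, id :: (nat \<Rightarrow> real) \<Rightarrow> nat \<Rightarrow> real)"
  let ?X = "fst (s ?c p)" and ?Y = "fst (s' ?c p)"
  define a b where "a q = fst (snd (s ?c q))" and "b q = fst (snd (s' ?c q))" for q
  define D where "D i h = mat n n (\<lambda>(r, k). cpd ?c i (\<lambda>q. h q $$ (r, k)) p)" for i and h :: "(nat \<Rightarrow> real) \<Rightarrow> real mat"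
  have D: "D i (\<lambda>q. axis_flip n (e q) (a q)) = axis_flip n (e p) (D i a)"
    "D i (\<lambda>q. axis_flip n (e q) (b q)) = axis_flip n (e p) (D i b)" if "i < 2" for i
    using cpd_axis_flip[OF V e(1) s(1) p that] cpd_axis_flip[OF V e(1) s(2) p that]
    by (auto simp: D_def a_def b_def axis_flip_index intro!: eq_matI)
  have carr: "a p \<in> carrier_mat n n" "b p \<in> carrier_mat n n"
    using section_so[OF s(1) V(2) p] section_so[OF s(2) V(2) p] by (auto simp: a_def b_def so_carrier)
  have Dc: "D i h \<in> carrier_mat n n" for i h by (simp add: D_def)
  have lc: "lie (a p) (b p) \<in> carrier_mat n n" using carr by (simp add: lie_def minus_carrier_mat)
  have mid: "axis_flip n (e p) (mat n n (\<lambda>(r, k). \<Sum>j<2. ?X j * D j b $$ (r, k) - ?Y j * D j a $$ (r, k))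
      + lie (a p) (b p))
    = mat n n (\<lambda>(r, k). \<Sum>j<2. ?X j * D j (\<lambda>q. axis_flip n (e q) (b q)) $$ (r, k)
        - ?Y j * D j (\<lambda>q. axis_flip n (e q) (a q)) $$ (r, k))
      + lie (axis_flip n (e p) (a p)) (axis_flip n (e p) (b p))"
    (is "?l = ?r")
  proof -
    have "?r = mat n n (\<lambda>(r, k). \<Sum>j<2. ?X j * axis_flip n (e p) (D j b) $$ (r, k)
        - ?Y j * axis_flip n (e p) (D j a) $$ (r, k)) + axis_flip n (e p) (lie (a p) (b p))"
      using axis_flip_lie[OF e(2)[OF p] carr] by (simp add: D)
    also have "\<dots> = ?l"
      using lc by (intro eq_matI) (simp_all add: axis_flip_index algebra_simps sum_distrib_left cong: if_cong)
    finally show ?thesis by simp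
  qed
  have last: "ipg n (axis_flip n (e p) (b p)) (D i (\<lambda>q. axis_flip n (e q) (a q))) = ipg n (b p) (D i a)"
    if "i < 2" for i
    unfolding D(1)[OF that] by (rule ipg_axis_flip[OF e(2)[OF p] carr(2) Dc])
  show ?thesis
    unfolding elt_eq_def apply_flip_triple cbracket_def Let_def fst_conv snd_conv
      a_def[symmetric] b_def[symmetric] D_def[symmetric]
    using mid last by simp
qed

text \<open>With \<theta>, B, \<phi> and \<beta> zero, the equations of a 1-morphism have vanishing
  sides; the content is that the flip is a Courant automorphism.\<close>

lemma flat_one_morphism:
  assumes V: "openin (Euclidean_space 2) V" "V \<subseteq> pplane"
    and e: "locally_constant 2 V e" "\<And>p. p \<in> V \<Longrightarrow> e p * e p = 1"
  shows "one_morphism n pplane_mfd V (flip_triple n e) (\<lambda>c p is. 0\<^sub>m n n) (\<lambda>c p is. 0)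
    (\<lambda>c p is. 0\<^sub>m n n) (\<lambda>c p is. 0)"
proof -
  have pair: "pairing n 2 (apply_triple n 2 (flip_triple n e) (pplane, id) p (s (pplane, id) p))
      (apply_triple n 2 (flip_triple n e) (pplane, id) p (s' (pplane, id) p))
    = pairing n 2 (s (pplane, id) p) (s' (pplane, id) p)"
    if "is_section n pplane_mfd V s" "is_section n pplane_mfd V s'" "p \<in> V" for s s' p
    using section_so[OF that(1) V(2) that(3)] section_so[OF that(2) V(2) that(3)] e(2)[OF that(3)]
    by (simp add: apply_flip_triple pairing_def split_beta ipg_axis_flip so_carrier)
  have aut: "courant_automorphism n pplane_mfd V (flip_triple n e)"
    unfolding courant_automorphism_def prod.case
    using so_form_zero[OF V] lie_automorphism_axis_flip[OF V e] tensor_field_zero[OF V]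
      pair cbracket_flip_triple[OF V e] by simp
  have flip0: "axis_flip n x (0\<^sub>m n n) = 0\<^sub>m n n" for x
    by (rule eq_matI) (auto simp: axis_flip_index)
  have "tens_eq pplane_mfd 3 V (\<lambda>c p is. cs3 n (\<lambda>c p is. 0\<^sub>m n n) c p is - cs3 n (\<lambda>c p is. 0\<^sub>m n n) c p is)
      (ext_d (\<lambda>c p is. 0 - 0))"
    using V(2) by (auto simp: tens_eq_def ext_d_zero idx_def)
  moreover have "tens_eq pplane_mfd 1 V (\<lambda>c p is. 0\<^sub>m n n) (\<lambda>c p is. axis_flip n (e p) (0\<^sub>m n n) + 0\<^sub>m n n)"
    by (auto simp: tens_eq_def flip0)
  ultimately show ?thesis
    unfolding one_morphism_def prod.case using aut by (simp add: flip0 ipg_zero)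
qed

section \<open>The Moebius data and their nontriviality\<close>

text \<open>The plane without a closed half axis: the nonnegative one for index 0, the nonpositive
  one for all other indices, which are copies because the index type is \<open>nat\<close>. The two
  kinds overlap in the open upper and lower half planes.\<close>

definition cut_plane :: "nat \<Rightarrow> (nat \<Rightarrow> real) set" where
  "cut_plane i = {x \<in> pplane. x 1 \<noteq> 0 \<or> (if i = 0 then x 0 < 0 else x 0 > 0)}"

text \<open>The indices matter only through being 0 or not, so the cocycle identity holds at every
  point and not just on triple overlaps. The jump at \<open>x 1 = 0\<close> is harmless, as the two
  kinds of cut planes do not meet there.\<close>

definition moebius_sign :: "nat \<Rightarrow> nat \<Rightarrow> (nat \<Rightarrow> real) \<Rightarrow> real" where
  "moebius_sign i j x = (if (i = 0) = (j = 0) \<or> x 1 > 0 then 1 else - 1)"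

definition moebius_data :: "nat \<Rightarrow> (nat, nat \<Rightarrow> real) courant_data" where
  "moebius_data n = \<lparr>cd_U = cut_plane, cd_theta = (\<lambda>i c p is. 0\<^sub>m n n), cd_B = (\<lambda>i c p is. 0),
     cd_L = (\<lambda>i j. flip_triple n (moebius_sign i j))\<rparr>"

lemma moebius_sign_square: "moebius_sign i j p * moebius_sign i j p = 1"
  by (simp add: moebius_sign_def)

lemma moebius_sign_cocycle: "moebius_sign i j p * moebius_sign j k p = moebius_sign i k p"
  by (auto simp: moebius_sign_def)

lemma openin_cut_plane: "openin (Euclidean_space 2) (cut_plane i)"
proof -
  have "cut_plane i = pplane \<inter>
    (topspace (Euclidean_space 2) \<inter> ({x. x 1 \<noteq> 0} \<union> (if i = 0 then {x. x 0 < 0} else {x. x 0 > 0})))"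
    by (auto simp: cut_plane_def pplane_def)
  moreover have "open ({x :: nat \<Rightarrow> real. x 1 \<noteq> 0} \<union> (if i = 0 then {x. x 0 < 0} else {x. x 0 > 0}))"
    using open_coord_Collect(1)[of 0 0] open_coord_Collect(2)[of 0 0] open_coord_Collect(3)[of 1 0] by auto
  ultimately show ?thesis
    by (metis openin_Int openin_pplane openin_Euclidean_Collect)
qed

lemma locally_constant_moebius_sign:
  "locally_constant 2 (cut_plane i \<inter> cut_plane j) (moebius_sign i j)"
  unfolding locally_constant_def
proof
  fix x assume x: "x \<in> cut_plane i \<inter> cut_plane j"
  let ?E = "topspace (Euclidean_space 2)"
  have xE: "x \<in> ?E" using x by (simp add: cut_plane_def pplane_def)
  consider "(i = 0) = (j = 0)" | "(i = 0) \<noteq> (j = 0)" "x 1 > 0" | "(i = 0) \<noteq> (j = 0)" "x 1 < 0"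
    using x by (fastforce simp: cut_plane_def split: if_splits)
  then show "\<exists>W. openin (Euclidean_space 2) W \<and> x \<in> W \<and> (\<forall>y\<in>W. moebius_sign i j y = moebius_sign i j x)"
  proof cases
    case 1
    then show ?thesis using xE by (intro exI[of _ ?E]) (auto simp: moebius_sign_def)
  next
    case 2
    then show ?thesis
      using xE openin_Euclidean_Collect[OF open_coord_Collect(2)[of 0 1]]
      by (intro exI[of _ "?E \<inter> {x. x 1 > 0}"]) (auto simp: moebius_sign_def)
  next
    case 3
    then show ?thesis
      using xE openin_Euclidean_Collect[OF open_coord_Collect(1)[of 1 0]]
      by (intro exI[of _ "?E \<inter> {x. x 1 < 0}"]) (auto simp: moebius_sign_def)
  qed
qed

lemma cut_plane_subset: "cut_plane i \<subseteq> pplane"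
  by (auto simp: cut_plane_def)

lemma courant_data_moebius: "courant_data n pplane_mfd (moebius_data n)"
proof -
  have "(\<Union>i. cut_plane i) = pplane"
  proof
    have "pplane \<subseteq> cut_plane 0 \<union> cut_plane 1" by (auto simp: cut_plane_def pplane_def)
    then show "pplane \<subseteq> (\<Union>i. cut_plane i)" by blast
  qed (use cut_plane_subset in blast)
  moreover have "openin (subtopology (Euclidean_space 2) pplane) (cut_plane i)" for i
    using openin_cut_plane[of i] cut_plane_subset[of i] openin_pplane
    by (simp add: openin_open_subtopology)
  moreover have "topspace (subtopology (Euclidean_space 2) pplane) = pplane"
    by (auto simp: pplane_def)
  ultimately have 1: "open_cover pplane_mfd cut_plane" by (simp add: open_cover_def)
  have 2: "one_morphism n pplane_mfd (cut_plane i \<inter> cut_plane j) (flip_triple n (moebius_sign i j))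
    (\<lambda>c p is. 0\<^sub>m n n) (\<lambda>c p is. 0) (\<lambda>c p is. 0\<^sub>m n n) (\<lambda>c p is. 0)" for i j
    using cut_plane_subset openin_cut_plane locally_constant_moebius_sign moebius_sign_square
    by (intro flat_one_morphism openin_Int) auto
  have 3: "triple_comp_eq n pplane_mfd V (flip_triple n (moebius_sign i j))
    (flip_triple n (moebius_sign j k)) (flip_triple n (moebius_sign i k)) (triple_id n)" for V i j k
    unfolding triple_comp_eq_def
    by (auto simp: apply_flip_triple apply_triple_id so_carrier axis_flip_axis_flip moebius_sign_cocycle elt_eq_def)
  show ?thesis
    using 1 2 3 so_form_zero[OF openin_cut_plane cut_plane_subset]
      diff_form_zero[OF openin_cut_plane cut_plane_subset]
    by (simp add: courant_data_def moebius_data_def Let_def)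
qed

section \<open>From bundle maps to determinants\<close>

lemma so4_det_Ad:
  assumes "g \<in> Spin 4"
  shows "so4_det (Ad 4 g) = 1"
proof -
  obtain vs where vs: "g = foldr (cl_mul 4) (map (cl_vec 4) vs) cl_one" "even (length vs)"
    "\<forall>v\<in>set vs. (\<Sum>i<4. (v i)\<^sup>2) = 1"
    using assms unfolding Spin_def by blast
  have "Ad 4 g = conj_op (rho 4 g)" by (rule ext) (simp add: Ad_def conj_op_def)
  then show ?thesis
    using so4_det_half_turns[OF vs(3,2)] rho_half_turns[OF vs(3)] vs(1) by simp
qed

lemma so_linear_Ad: "so_linear n (Ad n g)"
proof -
  have "Ad n g = conj_op (rho n g)" by (rule ext) (simp add: Ad_def conj_op_def)
  then show ?thesis using so_linear_conj[of "rho n g" n] by (simp add: rho_def)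
qed

text \<open>A zero tangent vector switches off \<phi> in the middle component and leaves \<tau>
  alone.\<close>

lemma apply_triple_so:
  assumes "fst (snd L) p a \<in> carrier_mat n n"
  shows "fst (snd (apply_triple n d L c p (\<lambda>_. 0, a, \<xi>))) = fst (snd L) p a"
    "fst (apply_triple n d L c p (\<lambda>_. 0, a, \<xi>)) = (\<lambda>_. 0)"
  using assms by (auto simp: apply_triple_def split_beta intro!: eq_matI)

text \<open>Test on (0, a, 0): the 1-form produced by the inner map is invisible to the middle
  component of the outer one.\<close>

lemma triple_comp_eq_so:
  assumes eq: "triple_comp_eq n M V L1 L2 L3 L4" and c: "c \<in> matlas M" "p \<in> V \<inter> fst c"
    and so: "\<And>L. L \<in> {L1, L2, L3, L4} \<Longrightarrow> so_linear n (fst (snd L) p)" and a: "a \<in> so n"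
  shows "fst (snd L1) p (fst (snd L2) p a) = fst (snd L3) p (fst (snd L4) p a)"
proof -
  have *: "fst (snd L) p b \<in> so n" if "L \<in> {L1, L2, L3, L4}" "b \<in> so n" for L b
    using so[OF that(1)] that(2) by (auto simp: so_linear_def)
  have **: "fst (snd (apply_triple n (mdim M) L c p (apply_triple n (mdim M) L' c p (\<lambda>_. 0, a, \<xi>))))
    = fst (snd L) p (fst (snd L') p a)" if mem: "L \<in> {L1, L2, L3, L4}" "L' \<in> {L1, L2, L3, L4}" for L L' \<xi>
  proof -
    obtain \<xi>' where "apply_triple n (mdim M) L' c p (\<lambda>_. 0, a, \<xi>) = (\<lambda>_. 0, fst (snd L') p a, \<xi>')"
      using apply_triple_so[of L' p a n "mdim M" c \<xi>] so_carrier[OF *[OF mem(2) a]] by (metis prod.collapse)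
    then show ?thesis
      using apply_triple_so(1)[of L p _ n "mdim M" c \<xi>'] so_carrier[OF *[OF mem(1) *[OF mem(2) a]]] by simp
  qed
  have "elt_eq (mdim M) (apply_triple n (mdim M) L1 c p (apply_triple n (mdim M) L2 c p (\<lambda>_. 0, a, \<lambda>_. 0)))
     (apply_triple n (mdim M) L3 c p (apply_triple n (mdim M) L4 c p (\<lambda>_. 0, a, \<lambda>_. 0)))"
    using eq c a unfolding triple_comp_eq_def by blast
  then show ?thesis by (simp add: elt_eq_def **)
qed

lemma lie_automorphism_linear:
  "lie_automorphism_field n M V \<tau> \<Longrightarrow> p \<in> V \<Longrightarrow> so_linear n (\<tau> p)"
  by (auto simp: lie_automorphism_field_def so_linear_def intro: bij_betw_apply)

lemma lie_automorphism_so4_det: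
  assumes "lie_automorphism_field 4 M V \<tau>" "p \<in> V"
  shows "so4_det (\<tau> p) \<noteq> 0"
  using assms by (intro so4_det_isometry lie_automorphism_linear[OF assms])
    (auto simp: lie_automorphism_field_def)

text \<open>By the Leibniz formula the determinant is a polynomial in the entries of \<tau> on the
  fixed matrices \<open>so4_basis l\<close>, and these entries are smooth.\<close>

lemma continuous_on_so4_det:
  assumes "lie_automorphism_field 4 pplane_mfd W \<tau>" "openin (Euclidean_space 2) W" "W \<subseteq> pplane"
  shows "continuous_on W (\<lambda>p. so4_det (\<tau> p))"
proof -
  have *: "continuous_on W (\<lambda>p. so4_matrix (\<tau> p) $$ (k, l))" if kl: "k < 6" "l < 6" for k l
  proof -
    obtain r s where rs: "so4_pair k = (r, s)" "r < 4" "s < 4"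
      using so4_pair_less[OF kl(1)] by (cases "so4_pair k") auto
    have "smooth_fun pplane_mfd W (\<lambda>p. \<tau> p (so4_basis l) $$ (r, s))"
      using assms(1) rs so4_basis_so[OF kl(2)] unfolding lie_automorphism_field_def by blast
    then have "smooth_on 2 W (\<lambda>p. \<tau> p (so4_basis l) $$ (r, s))"
      using smooth_on_chart_iff[OF assms(2,3), of "\<lambda>p. \<tau> p (so4_basis l) $$ (r, s)"]
      by (simp add: smooth_fun_def)
    then have "continuous_on W (foldr pd [] (\<lambda>p. \<tau> p (so4_basis l) $$ (r, s)))"
      unfolding smooth_on_def by (metis empty_set empty_subsetI)
    then show ?thesis using rs(1) kl by (simp add: so4_matrix_def)
  qed
  have "so4_det (\<tau> p) = (\<Sum>\<pi> | \<pi> permutes {0..<6}. signof \<pi> * (\<Prod>i = 0..<6. so4_matrix (\<tau> p) $$ (i, \<pi> i)))" for p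
    by (simp add: so4_det_def det_def so4_matrix_def)
  moreover have "continuous_on W (\<lambda>p. \<Sum>\<pi> | \<pi> permutes {0..<6}.
      signof \<pi> * (\<Prod>i = 0..<6. so4_matrix (\<tau> p) $$ (i, \<pi> i)))"
  proof (intro continuous_intros *)
    fix \<pi> i assume "\<pi> \<in> {\<pi>. \<pi> permutes {0..<6 :: nat}}" "i \<in> {0..<6 :: nat}"
    then show "i < 6" "\<pi> i < 6" using permutes_in_image[of \<pi> "{0..<6}" i] by auto
  qed
  ultimately show ?thesis by simp
qed

text \<open>For \<sigma> = 1 and -1 these are the halves of the square with vertices (1,0), (0,1),
  (-1,0), (0,-1), both running from (0,-1) at t = -1 to (0,1) at t = 1 and passing the origin on
  different sides.\<close>

definition half_path :: "real \<Rightarrow> real \<Rightarrow> nat \<Rightarrow> real" where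
  "half_path \<sigma> t = (\<lambda>i. if i = 0 then \<sigma> * (1 - \<bar>t\<bar>) else if i = 1 then t else 0)"

lemma continuous_on_half_path: "continuous_on A (half_path \<sigma>)"
proof (rule continuous_on_coordinatewise_then_product)
  fix i
  show "continuous_on A (\<lambda>t. half_path \<sigma> t i)"
    unfolding half_path_def by (cases "i = 0"; cases "i = 1") (auto intro!: continuous_intros)
qed

lemma half_path_in_cut_plane:
  assumes "\<bar>t\<bar> \<le> 1"
  shows "half_path (if i = 0 then - 1 else 1) t \<in> cut_plane i"
  using assms
  by (auto simp: half_path_def cut_plane_def pplane_def topspace_Euclidean_space)

lemma connected_nonzero_same_sign:
  fixes f :: "real \<Rightarrow> real"
  assumes "continuous_on {a..b} f" "\<And>t. t \<in> {a..b} \<Longrightarrow> f t \<noteq> 0" "a \<le> b"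
  shows "f a * f b > 0"
proof (rule ccontr)
  assume "\<not> f a * f b > 0"
  moreover have "f a \<noteq> 0" "f b \<noteq> 0" using assms by simp_all
  ultimately have "f a \<le> 0 \<and> 0 \<le> f b \<or> f b \<le> 0 \<and> 0 \<le> f a"
    by (metis linorder_le_cases mult_nonneg_nonneg mult_nonpos_nonpos mult_eq_0_iff order_le_less)
  then obtain x where "a \<le> x" "x \<le> b" "f x = 0"
    using IVT'[of f a 0 b] IVT2'[of f b 0 a] assms by blast
  then show False using assms(2)[of x] by simp
qed

text \<open>The \<open>D r\<close> are the local expressions of a nowhere vanishing section of the Moebius line
  bundle. Over the two cut planes it becomes a pair of functions of constant sign, which agree on the
  upper and are opposite on the lower half plane.\<close>

lemma moebius_no_section:
  fixes ix :: "'r \<Rightarrow> nat" and W :: "'r \<Rightarrow> (nat \<Rightarrow> real) set" and D :: "'r \<Rightarrow> (nat \<Rightarrow> real) \<Rightarrow> real"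
  assumes cover: "pplane \<subseteq> (\<Union>r\<in>R. W r)"
    and W: "\<And>r. r \<in> R \<Longrightarrow> openin (Euclidean_space 2) (W r)" "\<And>r. r \<in> R \<Longrightarrow> W r \<subseteq> cut_plane (ix r)"
    and D: "\<And>r. r \<in> R \<Longrightarrow> continuous_on (W r) (D r)" "\<And>r p. r \<in> R \<Longrightarrow> p \<in> W r \<Longrightarrow> D r p \<noteq> 0"
    and glue: "\<And>r r' p. r \<in> R \<Longrightarrow> r' \<in> R \<Longrightarrow> p \<in> W r \<inter> W r' \<Longrightarrow>
      moebius_sign (ix r) (ix r') p * D r' p = D r p"
  shows False
proof -
  define ch where "ch p = (SOME r. r \<in> R \<and> p \<in> W r)" for p
  have ch: "ch p \<in> R" "p \<in> W (ch p)" if "p \<in> pplane" for p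
    using someI_ex[of "\<lambda>r. r \<in> R \<and> p \<in> W r"] cover that unfolding ch_def by blast+
  \<comment> \<open>The section in the frame of cut plane i. The choice \<open>ch\<close> is not
    continuous, but by \<open>glue\<close> and the cocycle identity any other member of the cover at
    p gives the same value.\<close>
  define h where "h i p = moebius_sign i (ix (ch p)) p * D (ch p) p" for i p
  have h_eq: "h i p = moebius_sign i (ix r) p * D r p" if "r \<in> R" "p \<in> W r" for i r p
  proof -
    have "p \<in> pplane" using that W(2) cut_plane_subset by blast
    then have "D r p = moebius_sign (ix r) (ix (ch p)) p * D (ch p) p"
      using glue[of r "ch p" p] that ch by simp
    then show ?thesis
      by (simp add: h_def mult.assoc[symmetric] moebius_sign_cocycle)
  qed
  have nz: "h i p \<noteq> 0" if "p \<in> pplane" for i p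
    using D(2) ch[OF that] by (auto simp: h_def moebius_sign_def)
  have cont: "continuous_on {- 1..1} (\<lambda>t. h i (half_path (if i = 0 then - 1 else 1) t))" for i
    unfolding continuous_on_def
  proof
    let ?\<gamma> = "half_path (if i = 0 then - 1 else 1)"
    fix t :: real assume t: "t \<in> {- 1..1}"
    then have p: "?\<gamma> t \<in> cut_plane i" using half_path_in_cut_plane[of t i] by auto
    then have "?\<gamma> t \<in> pplane" using cut_plane_subset by blast
    note r = ch[OF this]
    let ?r = "ch (?\<gamma> t)"
    \<comment> \<open>On this open set one member of the cover represents \<open>h i\<close>, and
      the sign is locally constant because \<open>W ?r\<close> lies in the cut plane of its own
      index.\<close>
    let ?V = "W ?r \<inter> cut_plane i"
    have V: "openin (Euclidean_space 2) ?V" "?\<gamma> t \<in> ?V"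
      using W(1) r openin_cut_plane p by (auto intro: openin_Int)
    have "locally_constant 2 ?V (moebius_sign i (ix ?r))"
      using locally_constant_moebius_sign[of i "ix ?r"] W(2)[OF r(1)]
      unfolding locally_constant_def by blast
    then have "continuous_on ?V (moebius_sign i (ix ?r))"
      by (rule locally_constant_continuous_on[OF V(1)])
    moreover have "continuous_on ?V (D ?r)"
      by (rule continuous_on_subset[OF D(1)[OF r(1)]]) simp
    ultimately have "continuous_on ?V (\<lambda>p. moebius_sign i (ix ?r) p * D ?r p)"
      by (rule continuous_on_mult)
    then have c: "continuous_on ?V (h i)"
      by (rule continuous_on_eq) (use h_eq r(1) in auto)
    obtain T where T: "open T" "?V = T \<inter> {x. \<forall>i\<ge>2. x i = 0}"
      using V(1) by (auto simp: openin_Euclidean_space_iff)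
    have sub: "?\<gamma> s \<in> {x. \<forall>i\<ge>2. x i = 0}" for s by (simp add: half_path_def)
    have op: "open (?\<gamma> -` T)"
      using continuous_on_half_path[of UNIV] T(1) by (simp add: continuous_on_open_vimage)
    have "continuous_on (?\<gamma> -` T) (h i \<circ> ?\<gamma>)"
      by (rule continuous_on_compose[OF continuous_on_half_path])
        (rule continuous_on_subset[OF c], use T(2) sub in blast)
    moreover have "t \<in> ?\<gamma> -` T" using V(2) T(2) by blast
    ultimately have "isCont (h i \<circ> ?\<gamma>) t"
      using op continuous_on_eq_continuous_at by blast
    then show "((\<lambda>t. h i (?\<gamma> t)) \<longlongrightarrow> h i (?\<gamma> t)) (at t within {- 1..1})"
      unfolding isCont_def comp_def by (rule tendsto_within_subset) simp
  qed
  have sgn: "h i (half_path \<sigma> (- 1)) * h i (half_path \<sigma> 1) > 0"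
    if "\<sigma> = (if i = 0 then - 1 else 1)" for i \<sigma>
    unfolding that
  proof (rule connected_nonzero_same_sign[OF cont])
    fix t :: real assume "t \<in> {- 1..1}"
    then show "h i (half_path (if i = 0 then - 1 else 1) t) \<noteq> 0"
      using half_path_in_cut_plane[of t i] cut_plane_subset[of i] nz
      by (meson abs_le_iff atLeastAtMost_iff minus_le_iff subsetD)
  qed simp
  define N S where "N = half_path 1 1" and "S = half_path 1 (- 1)"
  have NS: "half_path \<sigma> 1 = N" "half_path \<sigma> (- 1) = S" for \<sigma>
    by (auto simp: N_def S_def half_path_def)
  \<comment> \<open>The two frames agree at N and are opposite at S, so the products of the end
    values along the two paths have opposite signs, while \<open>sgn\<close> makes both
    positive.\<close>
  have "h 0 p = moebius_sign 0 1 p * h 1 p" for p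
    by (simp add: h_def mult.assoc[symmetric] moebius_sign_cocycle)
  moreover have "moebius_sign 0 1 N = 1" "moebius_sign 0 1 S = - 1"
    by (simp_all add: moebius_sign_def N_def S_def half_path_def)
  ultimately show False
    using sgn[of "- 1" 0] sgn[of 1 1] by (simp add: NS)
qed

text \<open>Taking determinants in the gluing equations of an isomorphism removes the factor
  \<open>Ad\<close>; the determinants of its \<tau>-parts would then be a section excluded by
  \<open>moebius_no_section\<close>.\<close>

lemma not_courant_iso_moebius:
  assumes P: "string_data 4 S pplane_mfd P"
  shows "\<not> courant_iso 4 pplane_mfd (Phi 4 P) (moebius_data 4)"
proof
  assume "courant_iso 4 pplane_mfd (Phi 4 P) (moebius_data 4)"
  then obtain R L where cover: "(\<Union>(i, j, W)\<in>R. W) = topspace (mtop pplane_mfd)"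
    and R: "\<And>i j W. (i, j, W) \<in> R \<Longrightarrow> openin (mtop pplane_mfd) W \<and>
        W \<subseteq> cd_U (moebius_data 4) i \<inter> cd_U (Phi 4 P) j \<and>
        one_morphism 4 pplane_mfd W (L (i, j, W)) (cd_theta (Phi 4 P) j) (cd_B (Phi 4 P) j)
          (cd_theta (moebius_data 4) i) (cd_B (moebius_data 4) i)"
    and comp: "\<And>i1 j1 W1 i2 j2 W2. (i1, j1, W1) \<in> R \<Longrightarrow> (i2, j2, W2) \<in> R \<Longrightarrow>
        triple_comp_eq 4 pplane_mfd (W1 \<inter> W2) (cd_L (moebius_data 4) i1 i2) (L (i2, j2, W2))
          (L (i1, j1, W1)) (cd_L (Phi 4 P) j1 j2)"
    unfolding courant_iso_def by (fastforce simp: split_beta)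
  let ?W = "\<lambda>r. snd (snd r)" and ?D = "\<lambda>r p. so4_det (fst (snd (L r)) p)"
  have W: "openin (Euclidean_space 2) (?W r)" "?W r \<subseteq> cut_plane (fst r)"
    "?W r \<subseteq> sd_U P (fst (snd r))" if "r \<in> R" for r
    using R[of "fst r" "fst (snd r)" "?W r"] that openin_pplane
    by (auto simp: moebius_data_def Phi_def openin_open_subtopology)
  have aut: "lie_automorphism_field 4 pplane_mfd (?W r) (fst (snd (L r)))" if "r \<in> R" for r
    using R[of "fst r" "fst (snd r)" "?W r"] that
    by (auto simp: one_morphism_def courant_automorphism_def split_beta)
  have spin: "sd_g P j1 j2 p \<in> Spin 4" if "p \<in> sd_U P j1 \<inter> sd_U P j2" for j1 j2 p
    using P that unfolding string_data_def Let_def by blast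
  show False
  proof (rule moebius_no_section[where R = R and W = ?W and ix = fst and D = ?D])
    show "pplane \<subseteq> (\<Union>r\<in>R. ?W r)"
      using cover by (auto simp: pplane_def split_beta)
    show "continuous_on (?W r) (?D r)" if "r \<in> R" for r
      using continuous_on_so4_det[OF aut[OF that] W(1)[OF that]] W(2)[OF that] cut_plane_subset by blast
    show "?D r p \<noteq> 0" if "r \<in> R" "p \<in> ?W r" for r p
      using lie_automorphism_so4_det[OF aut] that .
    show "moebius_sign (fst r) (fst r') p * ?D r' p = ?D r p"
      if "r \<in> R" "r' \<in> R" "p \<in> ?W r \<inter> ?W r'" for r r' p
    proof -
      let ?g = "sd_g P (fst (snd r)) (fst (snd r')) p" and ?e = "moebius_sign (fst r) (fst r') p"
      have p: "p \<in> pplane" using that W(2) cut_plane_subset by blast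
      have lin: "so_linear 4 (fst (snd (L r)) p)" "so_linear 4 (fst (snd (L r')) p)"
        using lie_automorphism_linear[OF aut] that by auto
      have "so_linear 4 (fst (snd K) p)"
        if "K \<in> {cd_L (moebius_data 4) (fst r) (fst r'), L r', L r,
          cd_L (Phi 4 P) (fst (snd r)) (fst (snd r'))}" for K
        using that lin so_linear_Ad so_linear_axis_flip
        by (auto simp: moebius_data_def Phi_def Let_def)
      note comp_so = triple_comp_eq_so[where c = "(pplane, id)" and p = p, OF _ _ _ this]
      have "axis_flip 4 ?e (fst (snd (L r')) p a) = fst (snd (L r)) p (Ad 4 ?g a)" if "a \<in> so 4" for a
        using comp_so[OF comp[of "fst r" "fst (snd r)" "?W r" "fst r'" "fst (snd r')" "?W r'"], of a]
          \<open>r \<in> R\<close> \<open>r' \<in> R\<close> \<open>p \<in> ?W r \<inter> ?W r'\<close> that p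
        by (simp add: moebius_data_def Phi_def Let_def)
      then have "so4_det (\<lambda>a. axis_flip 4 ?e (fst (snd (L r')) p a))
          = so4_det (\<lambda>a. fst (snd (L r)) p (Ad 4 ?g a))"
        by (rule so4_det_cong)
      then have "so4_det (axis_flip 4 ?e) * ?D r' p = ?D r p * so4_det (Ad 4 ?g)"
        using lin so_linear_Ad so_linear_axis_flip by (simp add: so4_det_comp)
      moreover have "so4_det (Ad 4 ?g) = 1"
        using spin that W(3) by (intro so4_det_Ad) blast
      \<comment> \<open>The exponent is n - 1, odd because n is even, so the sign survives the
        determinant.\<close>
      moreover have "?e ^ 3 = ?e" by (simp add: moebius_sign_def)
      ultimately show ?thesis by (simp add: so4_det_axis_flip)
    qed
  qed (use W in auto)
qed

theorem lemma5p10: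
  shows "\<exists>n\<ge>3. \<exists>(M :: (nat \<Rightarrow> real) mfd) (T :: (nat, nat \<Rightarrow> real) courant_data).
    smooth_manifold M \<and> courant_data n M T \<and>
    (\<forall>(S :: 'i string_model) (P :: ('k, 'i, nat \<Rightarrow> real) string_data).
       string_presentation n S \<longrightarrow> string_data n S M P \<longrightarrow> \<not> courant_iso n M (Phi n P) T)"
  using smooth_manifold_pplane courant_data_moebius[of 4] not_courant_iso_moebius
  by (intro exI[of _ 4] conjI exI[of _ pplane_mfd] exI[of _ "moebius_data 4"]) auto

end
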